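(* Let $P\in D[y]$, let $P_1,\dots,P_s\in D[y]$ be nonzero, and let $N\in\mathbb{Z}_{>0}$. Then the procedure $\widehat{\mathcal D}$-approximate-division$(P,P_1,\dots,P_s,N)$ described in the context stops after finitely many steps and returns $\overline{Q_1},\dots,\overline{Q_s},\overline{R}\in D[y]$ such that (i) $P=\overline{Q_1}P_1+\cdots+\overline{Q_s}P_s+\overline{R}$; (ii) for each $i$, the terms of $\overline{Q_i}$ whose total degree is smaller than $N-|\mathrm{LE}_{<}(P_i)|$ agree with those of $Q_i$; (iii) the terms of $\overline{R}$ whose total degree is smaller than $N$ agree with those of $R$. Here $Q_1,\dots,Q_s,R\in\widehat{\mathcal D}[y]$ are the quotients and remainder of the $\widehat{\mathcal D}$-division of $P$ by $P_1,\dots,P_s$ (defined in the context).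
   Context: $K$ is a field of characteristic $0$, $x=(x_1,\dots,x_n)$, $\partial_i=\partial/\partial x_i$. $D$ is the ring of differential operators $\sum_\beta a_\beta(x)\partial^\beta$ (finite sums) with $a_\beta\in K[x]$, and $\widehat{\mathcal D}$ is the same with $a_\beta\in K[[x]]$. $y$ is a parameter commuting with everything; elements of $D[y]$, $\widehat{\mathcal D}[y]$ are written in normal form $\sum c_{\alpha\gamma\beta}x^\alpha y^\gamma\partial^\beta$. The total symbol is obtained by replacing $\partial$ by commutative variables $\xi=(\xi_1,\dots,\xi_n)$ in the normal form; exponents, terms and total degrees (total degree $|\alpha|+\gamma+|\beta|$, where $|\cdot|$ of an exponent vector denotes the sum of its entries) are those of the total symbol, with exponents in $(\mathbb{Z}_{\ge0})^{2n+1}$. $\mathrm{Exps}(\cdot)$ is the set of exponents appearing. Orders on monomials $x^\alpha y^\gamma\xi^\beta$: fix a term order $<_1$ (a multiplicative well-order). For $<$: first compare $\gamma+|\beta|$ (larger value is larger); if equal, compare $-|\alpha|$ (larger value is larger); if equal, use $<_1$. For $<_r$: first compare $-(|\alpha|+\gamma+|\beta|)$ (larger value is larger); if equal, use $<_1$. $\mathrm{LE}_{<}$, $\mathrm{LE}_{<_r}$ denote the leading (i.e. largest) exponents, $\mathrm{LT}_{<_r}$ the leading term, and $\mathrm{Rest}_{<_r}(g)=g-\mathrm{LT}_{<_r}(g)$. The weight vector $e$ gives weight $0$ to each $x_i$ and weight $1$ to $y$ and to each $\xi_i$; $\mathrm{ord}_e(P)$ is the maximal $e$-weight of an exponent of $P$;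 $\mathrm{in}_e(P)$ is the sum of the terms of the total symbol of $P$ of maximal $e$-weight. Partition: for exponents $\alpha(1),\dots,\alpha(s)\in(\mathbb{Z}_{\ge0})^m$ put $\Delta^1=\alpha(1)+(\mathbb{Z}_{\ge0})^m$, $\Delta^i=(\alpha(i)+(\mathbb{Z}_{\ge0})^m)\setminus(\Delta^1\cup\cdots\cup\Delta^{i-1})$ for $i\geq 2$, $\overline\Delta=(\mathbb{Z}_{\ge0})^m\setminus(\Delta^1\cup\cdots\cup\Delta^s)$. $\widehat{\mathcal D}$-division (Castro): for $P\in\widehat{\mathcal D}[y]$ and nonzero $P_1,\dots,P_s\in\widehat{\mathcal D}[y]$, with the partition taken with respect to $(\mathrm{LE}_<(P_1),\dots,\mathrm{LE}_<(P_s))$, there are unique $Q_1,\dots,Q_s,R\in\widehat{\mathcal D}[y]$ with $P=\sum Q_iP_i+R$, $\mathrm{LE}_<(P_i)+\mathrm{Exps}(Q_i)\subset\Delta^i$, $\mathrm{Exps}(R)\subset\overline\Delta$. Commutative approximate division, $K[[x]]$-approximate-division$(f,g_1,\dots,g_s,<_r,B)$, used here for polynomials $f$ and nonzero $g_1,\dots,g_s$ in the $2n+1$ variables $x,y,\xi$ and a bound $B$: start with $F\leftarrow f$, $q_i\leftarrow0$, $r\leftarrow0$. While $F\ne0$ and $|\mathrm{LE}_{<_r}(F)|<B$: let $q_1',\dots,q_s',r'$ be the unique elements with $F=\sum q_i'\,\mathrm{LT}_{<_r}(g_i)+r'$, $\mathrm{LE}_{<_r}(g_i)+\mathrm{Exps}(q_i')\subset\Delta^i$,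 $\mathrm{Exps}(r')\subset\overline\Delta$ (partition with respect to $(\mathrm{LE}_{<_r}(g_1),\dots,\mathrm{LE}_{<_r}(g_s))$); set $q_i\leftarrow q_i+q_i'$, $r\leftarrow r+r'$, $F\leftarrow-\sum q_i'\,\mathrm{Rest}_{<_r}(g_i)$. Return $q_1,\dots,q_s,r$ (and $F$). Procedure $\widehat{\mathcal D}$-approximate-division$(P,P_1,\dots,P_s,N)$: 1. $\overline{Q_i}\leftarrow0$ $(1\le i\le s)$, $\overline R\leftarrow P$, $m_0\leftarrow\mathrm{ord}_e(P)$. (If $P=0$, return all zeros.) 2. For $0\le k\le m_0$: $M_k\leftarrow\max\{|\mathrm{LE}_<(P_i)|+2(k-\mathrm{ord}_e(P_i)) : k\ge\mathrm{ord}_e(P_i)\}$, with $M_k=0$ if there is no such $i$. 3. $\mathrm{Bound}\leftarrow N+\sum_{k=0}^{m_0}M_k$. 4. For $k=m_0,m_0-1,\dots,0$: let $\overline r$ be the total symbol of the part of $\overline R$ consisting of the terms of $e$-order $k$ and total degree smaller than $\mathrm{Bound}$; let $\overline{q_i'}$ be the quotients of $K[[x]]$-approximate-division$(\overline r,\mathrm{in}_e(P_1),\dots,\mathrm{in}_e(P_s),<_r,\mathrm{Bound})$; let $\overline{Q_i'}$ be obtained from $\overline{q_i'}$ by replacing $\xi$ with $\partial$ (normally ordered); set $\overline R\leftarrow\overline R-\sum_{i=1}^s\overline{Q_i'}P_i$, $\overline{Q_i}\leftarrow\overline{Q_i}+\overline{Q_i'}$, $\mathrm{Bound}\leftarrow\mathrm{Bound}-M_k$.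 5. Return $\overline{Q_1},\dots,\overline{Q_s},\overline R$. *)

theory Defs
  imports
    Complex_Main
    "HOL-Library.Function_Algebras"
    "HOL-Library.Product_Plus"
    "HOL-Library.While_Combinator"
begin

text \<open>
  The variables \<open>x\<close> (and \<open>\<xi>\<close>) are indexed by a finite type \<open>'n\<close>, so \<open>n = CARD('n)\<close>.
  The exponent of \<open>x\<^sup>\<alpha> y\<^sup>\<gamma> \<xi>\<^sup>\<beta>\<close> (or of \<open>x\<^sup>\<alpha> y\<^sup>\<gamma> \<partial>\<^sup>\<beta>\<close>) is the triple
  \<open>(\<alpha>, \<gamma>, \<beta>)\<close>; exponents are added componentwise.

  An operator is identified with the coefficient function of its normal form, which is also that
  of its total symbol. Passing from an operator to its total symbol, and replacing \<open>\<xi>\<close> by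
  \<open>\<partial>\<close> in a symbol, is therefore the identity on coefficient functions; only the products
  differ. Sums and differences of coefficient functions are the pointwise ones. The pointwise
  product \<open>*\<close> of coefficient functions is not used.
\<close>

type_synonym 'n expo = "('n \<Rightarrow> nat) \<times> nat \<times> ('n \<Rightarrow> nat)"

type_synonym ('n, 'k) coeffs = "'n expo \<Rightarrow> 'k"

definition x_exp :: "'n expo \<Rightarrow> 'n \<Rightarrow> nat" where
  "x_exp u = fst u"

definition y_exp :: "'n expo \<Rightarrow> nat" where
  "y_exp u = fst (snd u)"

definition xi_exp :: "'n expo \<Rightarrow> 'n \<Rightarrow> nat" where
  "xi_exp u = snd (snd u)"

definition x_deg :: "'n::finite expo \<Rightarrow> nat" where
  "x_deg u = (\<Sum>i\<in>UNIV. x_exp u i)"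

definition e_weight :: "'n::finite expo \<Rightarrow> nat" where
  "e_weight u = y_exp u + (\<Sum>i\<in>UNIV. xi_exp u i)"

definition total_deg :: "'n::finite expo \<Rightarrow> nat" where
  "total_deg u = (\<Sum>i\<in>UNIV. x_exp u i) + y_exp u + (\<Sum>i\<in>UNIV. xi_exp u i)"

definition Exps :: "('n, 'k::zero) coeffs \<Rightarrow> 'n expo set" where
  "Exps P = {u. P u \<noteq> 0}"


subsection \<open>Operators\<close>

definition Dy :: "('n, 'k::zero) coeffs set" where
  "Dy = {P. finite (Exps P)}"

text \<open>
  Only finitely many monomials \<open>y\<^sup>\<gamma> \<partial>\<^sup>\<beta>\<close> occur, each with a coefficient in \<open>K[[x]]\<close>.
\<close>

definition Dhat_y :: "('n, 'k::zero) coeffs set" where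
  "Dhat_y = {P. finite (snd ` Exps P)}"

text \<open>
  The product of differential operators, in normal form. It is the bilinear extension of
  \<open>x\<^sup>\<alpha> y\<^sup>\<gamma> \<partial>\<^sup>\<beta> \<cdot> x\<^sup>\<alpha>\<^sup>' y\<^sup>\<gamma>\<^sup>' \<partial>\<^sup>\<beta>\<^sup>' =
    (\<Sum>\<kappa>. (\<Prod>i. \<kappa>\<^sub>i! (\<beta>\<^sub>i choose \<kappa>\<^sub>i) (\<alpha>'\<^sub>i choose \<kappa>\<^sub>i))
       x\<^sup>\<alpha>\<^sup>+\<^sup>\<alpha>\<^sup>'\<^sup>-\<^sup>\<kappa> y\<^sup>\<gamma>\<^sup>+\<^sup>\<gamma>\<^sup>' \<partial>\<^sup>\<beta>\<^sup>+\<^sup>\<beta>\<^sup>'\<^sup>-\<^sup>\<kappa>)\<close>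
  with \<open>\<kappa> \<le> \<beta>\<close> and \<open>\<kappa> \<le> \<alpha>'\<close>, which is Leibniz' rule for \<open>\<partial>\<^sup>\<beta> \<cdot> x\<^sup>\<alpha>\<^sup>'\<close>.
  For \<open>P\<close> and \<open>Q\<close> in \<open>Dhat_y\<close> the index set of the sum below is finite, because
  \<open>\<kappa>\<close> is bounded by the exponents of \<open>\<partial>\<close> in \<open>P\<close>.
\<close>

definition dmult :: "('n::finite, 'k::field_char_0) coeffs \<Rightarrow> ('n, 'k) coeffs \<Rightarrow> ('n, 'k) coeffs"
where
  "dmult P Q = (\<lambda>w.
     \<Sum>(u, v, \<kappa>) \<in> {(u, v, \<kappa>). u \<in> Exps P \<and> v \<in> Exps Q \<and>
                         \<kappa> \<le> xi_exp u \<and> \<kappa> \<le> x_exp v \<and> u + v = w + (\<kappa>, 0, \<kappa>)}.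
       of_nat (\<Prod>i\<in>UNIV. fact (\<kappa> i) * (xi_exp u i choose \<kappa> i) * (x_exp v i choose \<kappa> i))
         * P u * Q v)"

definition ord_e :: "('n::finite, 'k::zero) coeffs \<Rightarrow> nat" where
  "ord_e P = Max (e_weight ` Exps P)"

definition in_e :: "('n::finite, 'k::zero) coeffs \<Rightarrow> ('n, 'k) coeffs" where
  "in_e P = (\<lambda>u. if e_weight u = ord_e P then P u else 0)"


subsection \<open>Monomial orders and leading exponents\<close>

definition term_order :: "('n expo \<Rightarrow> 'n expo \<Rightarrow> bool) \<Rightarrow> bool" where
  "term_order lt \<longleftrightarrow> transp lt \<and> totalp lt \<and> wfp lt \<and>
     (\<forall>u v w. lt u v \<longrightarrow> lt (u + w) (v + w))"

definition less_e :: "('n::finite expo \<Rightarrow> 'n expo \<Rightarrow> bool) \<Rightarrow> 'n expo \<Rightarrow> 'n expo \<Rightarrow> bool" where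
  "less_e lt\<^sub>1 u v \<longleftrightarrow>
     e_weight u < e_weight v \<or>
     e_weight u = e_weight v \<and> (x_deg v < x_deg u \<or> x_deg u = x_deg v \<and> lt\<^sub>1 u v)"

definition less_r :: "('n::finite expo \<Rightarrow> 'n expo \<Rightarrow> bool) \<Rightarrow> 'n expo \<Rightarrow> 'n expo \<Rightarrow> bool" where
  "less_r lt\<^sub>1 u v \<longleftrightarrow>
     total_deg v < total_deg u \<or> total_deg u = total_deg v \<and> lt\<^sub>1 u v"

definition LE :: "('n expo \<Rightarrow> 'n expo \<Rightarrow> bool) \<Rightarrow> ('n, 'k::zero) coeffs \<Rightarrow> 'n expo" where
  "LE lt P = (THE u. u \<in> Exps P \<and> (\<forall>v\<in>Exps P. v \<noteq> u \<longrightarrow> lt v u))"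

definition LT :: "('n expo \<Rightarrow> 'n expo \<Rightarrow> bool) \<Rightarrow> ('n, 'k::zero) coeffs \<Rightarrow> ('n, 'k) coeffs" where
  "LT lt P = (\<lambda>u. if u = LE lt P then P u else 0)"

definition Rest :: "('n expo \<Rightarrow> 'n expo \<Rightarrow> bool) \<Rightarrow> ('n, 'k::ab_group_add) coeffs \<Rightarrow> ('n, 'k) coeffs"
where
  "Rest lt P = P - LT lt P"


subsection \<open>The partition of the exponents and the division in \<open>Dhat_y\<close>\<close>

definition expo_cone :: "'n expo \<Rightarrow> 'n expo set" where
  "expo_cone a = range (\<lambda>u. a + u)"

fun Delta :: "'n expo list \<Rightarrow> nat \<Rightarrow> 'n expo set" where
  "Delta as i = expo_cone (as ! i) - (\<Union>j\<in>{..<i}. Delta as j)"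

declare Delta.simps [simp del]

definition Delta_bar :: "'n expo list \<Rightarrow> 'n expo set" where
  "Delta_bar as = UNIV - (\<Union>i<length as. Delta as i)"

definition is_Dhat_division ::
  "('n::finite expo \<Rightarrow> 'n expo \<Rightarrow> bool) \<Rightarrow> ('n, 'k::field_char_0) coeffs \<Rightarrow> ('n, 'k) coeffs list \<Rightarrow>
   ('n, 'k) coeffs list \<Rightarrow> ('n, 'k) coeffs \<Rightarrow> bool"
where
  "is_Dhat_division lt\<^sub>1 P Ps Qs R \<longleftrightarrow>
     length Qs = length Ps \<and> set Qs \<subseteq> Dhat_y \<and> R \<in> Dhat_y \<and>
     P = (\<Sum>i<length Ps. dmult (Qs ! i) (Ps ! i)) + R \<and>
     (\<forall>i<length Ps. (\<lambda>u. LE (less_e lt\<^sub>1) (Ps ! i) + u) ` Exps (Qs ! i)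
                       \<subseteq> Delta (map (LE (less_e lt\<^sub>1)) Ps) i) \<and>
     Exps R \<subseteq> Delta_bar (map (LE (less_e lt\<^sub>1)) Ps)"


subsection \<open>Commutative approximate division\<close>

definition cmult :: "('n, 'k::comm_semiring_0) coeffs \<Rightarrow> ('n, 'k) coeffs \<Rightarrow> ('n, 'k) coeffs" where
  "cmult f g = (\<lambda>w. \<Sum>(u, v) \<in> {(u, v). u + v = w}. f u * g v)"

text \<open>
  The coefficient functions with finite support, \<open>Dy\<close>, serve here as the polynomials in
  \<open>x, y, \<xi>\<close>.
\<close>

definition is_LT_division ::
  "('n expo \<Rightarrow> 'n expo \<Rightarrow> bool) \<Rightarrow> ('n, 'k::field_char_0) coeffs \<Rightarrow> ('n, 'k) coeffs list \<Rightarrow>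
   ('n, 'k) coeffs list \<Rightarrow> ('n, 'k) coeffs \<Rightarrow> bool"
where
  "is_LT_division lt F gs qs r \<longleftrightarrow>
     length qs = length gs \<and> set qs \<subseteq> Dy \<and> r \<in> Dy \<and>
     F = (\<Sum>i<length gs. cmult (qs ! i) (LT lt (gs ! i))) + r \<and>
     (\<forall>i<length gs. (\<lambda>u. LE lt (gs ! i) + u) ` Exps (qs ! i) \<subseteq> Delta (map (LE lt) gs) i) \<and>
     Exps r \<subseteq> Delta_bar (map (LE lt) gs)"

definition LT_division ::
  "('n expo \<Rightarrow> 'n expo \<Rightarrow> bool) \<Rightarrow> ('n, 'k::field_char_0) coeffs \<Rightarrow> ('n, 'k) coeffs list \<Rightarrow>
   ('n, 'k) coeffs list \<times> ('n, 'k) coeffs"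
where
  "LT_division lt F gs = (THE (qs, r). is_LT_division lt F gs qs r)"

text \<open>
  The state is \<open>(qs, r, F)\<close>. The result is \<open>None\<close> if and only if the loop does not terminate.
\<close>

definition Kx_approx_division ::
  "('n::finite expo \<Rightarrow> 'n expo \<Rightarrow> bool) \<Rightarrow> ('n, 'k::field_char_0) coeffs \<Rightarrow> ('n, 'k) coeffs list \<Rightarrow>
   nat \<Rightarrow> (('n, 'k) coeffs list \<times> ('n, 'k) coeffs \<times> ('n, 'k) coeffs) option"
where
  "Kx_approx_division lt f gs B =
     while_option
       (\<lambda>(qs, r, F). F \<noteq> 0 \<and> total_deg (LE lt F) < B)
       (\<lambda>(qs, r, F).
          let (qs', r') = LT_division lt F gs
          in (map2 (+) qs qs', r + r', - (\<Sum>i<length gs. cmult (qs' ! i) (Rest lt (gs ! i)))))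
       (replicate (length gs) 0, 0, f)"


subsection \<open>Approximate division of differential operators\<close>

definition M_bound ::
  "('n::finite expo \<Rightarrow> 'n expo \<Rightarrow> bool) \<Rightarrow> ('n, 'k::zero) coeffs list \<Rightarrow> nat \<Rightarrow> nat"
where
  "M_bound lt\<^sub>1 Ps k =
     (let S = {total_deg (LE (less_e lt\<^sub>1) (Ps ! i)) + 2 * (k - ord_e (Ps ! i)) | i.
                 i < length Ps \<and> ord_e (Ps ! i) \<le> k}
      in if S = {} then 0 else Max S)"

definition low_part :: "nat \<Rightarrow> nat \<Rightarrow> ('n::finite, 'k::zero) coeffs \<Rightarrow> ('n, 'k) coeffs" where
  "low_part k B R = (\<lambda>u. if e_weight u = k \<and> total_deg u < B then R u else 0)"

text \<open>
  One pass of the main loop, on the state \<open>(Bound, Qs, R)\<close>. At pass \<open>k\<close> the bound is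
  \<open>N\<close> plus the values of \<open>M_bound\<close> at \<open>0, \<dots>, k\<close>, so the subtraction on \<open>nat\<close> does not
  truncate.
\<close>

definition approx_step ::
  "('n::finite expo \<Rightarrow> 'n expo \<Rightarrow> bool) \<Rightarrow> ('n, 'k::field_char_0) coeffs list \<Rightarrow> nat \<Rightarrow>
   nat \<times> ('n, 'k) coeffs list \<times> ('n, 'k) coeffs \<Rightarrow>
   (nat \<times> ('n, 'k) coeffs list \<times> ('n, 'k) coeffs) option"
where
  "approx_step lt\<^sub>1 Ps k = (\<lambda>(B, Qs, R).
     case Kx_approx_division (less_r lt\<^sub>1) (low_part k B R) (map in_e Ps) B of
       None \<Rightarrow> None
     | Some (qs, r, F) \<Rightarrow>
         Some (B - M_bound lt\<^sub>1 Ps k,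
               map2 (+) Qs qs,
               R - (\<Sum>i<length Ps. dmult (qs ! i) (Ps ! i))))"

text \<open>\<open>approx_loop lt\<^sub>1 Ps m\<close> performs the passes \<open>m - 1, m - 2, \<dots>, 0\<close>, in this order.\<close>

primrec approx_loop ::
  "('n::finite expo \<Rightarrow> 'n expo \<Rightarrow> bool) \<Rightarrow> ('n, 'k::field_char_0) coeffs list \<Rightarrow> nat \<Rightarrow>
   nat \<times> ('n, 'k) coeffs list \<times> ('n, 'k) coeffs \<Rightarrow>
   (nat \<times> ('n, 'k) coeffs list \<times> ('n, 'k) coeffs) option"
where
  "approx_loop lt\<^sub>1 Ps 0 st = Some st"
| "approx_loop lt\<^sub>1 Ps (Suc k) st = Option.bind (approx_step lt\<^sub>1 Ps k st) (approx_loop lt\<^sub>1 Ps k)"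

definition Dhat_approx_division ::
  "('n::finite expo \<Rightarrow> 'n expo \<Rightarrow> bool) \<Rightarrow> ('n, 'k::field_char_0) coeffs \<Rightarrow> ('n, 'k) coeffs list \<Rightarrow>
   nat \<Rightarrow> (('n, 'k) coeffs list \<times> ('n, 'k) coeffs) option"
where
  "Dhat_approx_division lt\<^sub>1 P Ps N =
     (if P = 0 then Some (replicate (length Ps) 0, 0)
      else map_option snd
        (approx_loop lt\<^sub>1 Ps (Suc (ord_e P))
           (N + (\<Sum>k\<le>ord_e P. M_bound lt\<^sub>1 Ps k), replicate (length Ps) 0, P)))"

end

theory Submission
  imports Defs "HOL-Library.FuncSet"
begin

text \<open>
  Within one e-weight, \<open>less_e\<close> and \<open>less_r\<close> coincide, so the commutative division by the initial
  parts uses the same partition as the division of operators. Its loop stops because the leading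
  exponent strictly decreases among the finitely many exponents of degree below the bound.

  Put \<open>b k = N + M\<^sub>0 + \<dots> + M\<^sub>k\<close>. Pass \<open>k\<close> does not touch terms of weight above \<open>k\<close>, and after it the
  terms of the remainder of weight \<open>k\<close> and degree below \<open>b k\<close> lie in \<open>Delta_bar\<close>. Subtracting this
  representation of \<open>P\<close> from the exact division gives a division of \<open>0\<close> with remainder confined to
  \<open>Delta_bar\<close> in degrees below \<open>b\<close>. Descending in the weight, all its terms of degree below \<open>b\<close>
  vanish: otherwise the \<open>less_r\<close>-greatest of them in the highest weight occurs in one summand
  only, by disjointness of the partition.
\<close>

section \<open>Exponents\<close>

lemma sum_fun_apply: "(\<Sum>i\<in>A. f i) x = (\<Sum>i\<in>A. f i x)"
  for f :: "'i \<Rightarrow> 'a \<Rightarrow> 'b::comm_monoid_add"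
  by (induction A rule: infinite_finite_induct) auto

lemma total_deg_add [simp]: "total_deg (u + v) = total_deg u + total_deg v"
  by (simp add: total_deg_def x_exp_def y_exp_def xi_exp_def sum.distrib)

lemma e_weight_add [simp]: "e_weight (u + v) = e_weight u + e_weight v"
  by (simp add: e_weight_def y_exp_def xi_exp_def sum.distrib)

lemma total_deg_eq: "total_deg u = x_deg u + e_weight u"
  by (simp add: total_deg_def e_weight_def x_deg_def)

text \<open>In the Leibniz rule each derivative that hits a power of x removes one x and one
  derivation. So \<open>(\<kappa>, 0, \<kappa>)\<close> is lost from the sum of the exponents, twice
  in degree but once in weight; the final estimate plays these two rates against each other.\<close>

lemma total_deg_contraction [simp]: "total_deg (\<kappa>, 0, \<kappa>) = 2 * sum \<kappa> UNIV"
  by (simp add: total_deg_def x_exp_def y_exp_def xi_exp_def)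

lemma e_weight_contraction [simp]: "e_weight (\<kappa>, 0, \<kappa>) = sum \<kappa> UNIV"
  by (simp add: e_weight_def y_exp_def xi_exp_def)

section \<open>Finiteness of sets of exponents\<close>

lemma finite_fun_le: "finite {f :: 'n::finite \<Rightarrow> nat. f \<le> g}"
proof (rule finite_subset)
  show "{f. f \<le> g} \<subseteq> PiE UNIV (\<lambda>i. {..g i})"
    by (auto simp: le_fun_def)
  show "finite (PiE UNIV (\<lambda>i. {..g i}))"
    by (intro finite_PiE) auto
qed

text \<open>Every coordinate is at most the degree, which confines the exponents to a finite box.
  This makes the inner loop terminate and supplies a greatest element in the final
  comparison.\<close>

lemma finite_total_deg_less: "finite {u :: 'n::finite expo. total_deg u < B}"
proof (rule finite_subset)
  let ?F = "{f :: 'n \<Rightarrow> nat. f \<le> (\<lambda>_. B)}"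
  have le: "f i \<le> sum f UNIV" for f :: "'n \<Rightarrow> nat" and i
    by (simp add: member_le_sum)
  show "{u :: 'n expo. total_deg u < B} \<subseteq> ?F \<times> {..B} \<times> ?F"
  proof
    fix u :: "'n expo"
    assume u: "u \<in> {u. total_deg u < B}"
    obtain a c b where [simp]: "u = (a, c, b)" by (cases u)
    from u have *: "sum a UNIV + c + sum b UNIV < B"
      by (simp add: total_deg_def x_exp_def y_exp_def xi_exp_def)
    have "a i \<le> B" "b i \<le> B" for i
      using * le[of a i] le[of b i] by linarith+
    then show "u \<in> ?F \<times> {..B} \<times> ?F"
      using * by (auto simp: le_fun_def)
  qed
  show "finite (?F \<times> {..B} \<times> ?F)"
    using finite_fun_le by auto
qed

text \<open>Both summands have degree at most that of \<open>w\<close>. Hence the sum in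
  \<open>cmult\<close> has a finite index set; an infinite one would give 0 by default.\<close>

lemma finite_splits: "finite {(u, v). u + v = (w :: 'n::finite expo)}"
proof (rule finite_subset)
  let ?A = "{u :: 'n expo. total_deg u < Suc (total_deg w)}"
  show "{(u, v). u + v = w} \<subseteq> ?A \<times> ?A"
  proof
    fix x assume "x \<in> {(u, v). u + v = w}"
    then have "fst x + snd x = w" by (simp add: split_def)
    then have "total_deg (fst x) + total_deg (snd x) = total_deg w"
      by (metis total_deg_add)
    then show "x \<in> ?A \<times> ?A" by (simp add: mem_Times_iff)
  qed
  show "finite (?A \<times> ?A)" using finite_total_deg_less by auto
qed

text \<open>Degree bounds add up under products, so closure of \<open>Dy\<close> under both products
  is proved in this form.\<close>

lemma Dy_iff_bounded: "P \<in> Dy \<longleftrightarrow> (\<exists>B. \<forall>u\<in>Exps P. total_deg u < B)"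
  for P :: "('n::finite, 'k::zero) coeffs"
proof
  assume "P \<in> Dy"
  then have "finite (total_deg ` Exps P)" by (simp add: Dy_def)
  then show "\<exists>B. \<forall>u\<in>Exps P. total_deg u < B"
    by (auto simp: finite_nat_set_iff_bounded)
next
  assume "\<exists>B. \<forall>u\<in>Exps P. total_deg u < B"
  then obtain B where "Exps P \<subseteq> {u. total_deg u < B}" by auto
  then show "P \<in> Dy"
    unfolding Dy_def using finite_subset finite_total_deg_less by auto
qed

lemma Dy_subset: "P \<in> Dy \<Longrightarrow> Exps Q \<subseteq> Exps P \<Longrightarrow> Q \<in> Dy"
  by (auto simp: Dy_def intro: finite_subset)

lemma Dy_imp_Dhat_y: "P \<in> Dy \<Longrightarrow> P \<in> Dhat_y"
  by (auto simp: Dy_def Dhat_y_def)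

section \<open>Supports, and closure under sums and differences\<close>

lemma Exps_zero [simp]: "Exps 0 = {}"
  by (simp add: Exps_def)

lemma Exps_eq_empty_iff: "Exps P = {} \<longleftrightarrow> P = 0"
  by (auto simp: Exps_def fun_eq_iff)

lemma Exps_add: "Exps (P + Q) \<subseteq> Exps P \<union> Exps Q"
  for P Q :: "('n, 'k::monoid_add) coeffs"
  by (auto simp: Exps_def)

lemma Exps_diff: "Exps (P - Q) \<subseteq> Exps P \<union> Exps Q"
  for P Q :: "('n, 'k::group_add) coeffs"
  by (auto simp: Exps_def)

lemma Exps_uminus [simp]: "Exps (- P) = Exps P"
  for P :: "('n, 'k::group_add) coeffs"
  by (auto simp: Exps_def)

lemma Exps_sum: "Exps (\<Sum>i\<in>A. f i) \<subseteq> (\<Union>i\<in>A. Exps (f i))"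
  for f :: "'i \<Rightarrow> ('n, 'k::comm_monoid_add) coeffs"
  by (auto simp: Exps_def sum_fun_apply dest: sum.not_neutral_contains_not_neutral)

lemma Dy_zero [simp]: "0 \<in> Dy"
  by (simp add: Dy_def)

lemma Dy_add: "P \<in> Dy \<Longrightarrow> Q \<in> Dy \<Longrightarrow> P + Q \<in> Dy"
  for P Q :: "('n, 'k::monoid_add) coeffs"
  unfolding Dy_def using finite_subset[OF Exps_add] by blast

lemma Dy_diff: "P \<in> Dy \<Longrightarrow> Q \<in> Dy \<Longrightarrow> P - Q \<in> Dy"
  for P Q :: "('n, 'k::group_add) coeffs"
  unfolding Dy_def using finite_subset[OF Exps_diff] by blast

lemma Dy_uminus: "P \<in> Dy \<Longrightarrow> - P \<in> Dy"
  for P :: "('n, 'k::group_add) coeffs"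
  by (simp add: Dy_def)

lemma Dy_sum: "finite A \<Longrightarrow> (\<And>i. i \<in> A \<Longrightarrow> f i \<in> Dy) \<Longrightarrow> (\<Sum>i\<in>A. f i) \<in> Dy"
  for f :: "'i \<Rightarrow> ('n, 'k::comm_monoid_add) coeffs"
  by (induction A rule: finite_induct) (auto intro: Dy_add)

lemma Dhat_y_diff: "P \<in> Dhat_y \<Longrightarrow> Q \<in> Dhat_y \<Longrightarrow> P - Q \<in> Dhat_y"
  for P Q :: "('n, 'k::group_add) coeffs"
  unfolding Dhat_y_def using finite_subset[OF image_mono[OF Exps_diff[of P Q], of snd]]
  by (simp add: image_Un)

section \<open>Products\<close>

lemma cmult_nonzeroE:
  assumes "cmult f g w \<noteq> 0"
  obtains u v where "u + v = w" "u \<in> Exps f" "v \<in> Exps g"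
proof -
  obtain x where "x \<in> {(u, v). u + v = w}" "(case x of (u, v) \<Rightarrow> f u * g v) \<noteq> 0"
    using assms unfolding cmult_def by (rule sum.not_neutral_contains_not_neutral)
  then show thesis
    using that[of "fst x" "snd x"] mult_not_zero by (auto simp: Exps_def split_def)
qed

lemma cmult_Dy:
  fixes f g :: "('n::finite, 'k::comm_semiring_0) coeffs"
  assumes "f \<in> Dy" "g \<in> Dy"
  shows "cmult f g \<in> Dy"
proof -
  obtain B C where "\<forall>u\<in>Exps f. total_deg u < B" "\<forall>u\<in>Exps g. total_deg u < C"
    using assms Dy_iff_bounded by metis
  moreover have "\<exists>u\<in>Exps f. \<exists>v\<in>Exps g. w = u + v" if w: "w \<in> Exps (cmult f g)" for w
  proof -
    have "cmult f g w \<noteq> 0" using w by (simp add: Exps_def)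
    then show ?thesis by (rule cmult_nonzeroE) blast
  qed
  ultimately have "\<forall>w\<in>Exps (cmult f g). total_deg w < B + C"
    by (metis total_deg_add add_strict_mono)
  then show ?thesis using Dy_iff_bounded by blast
qed

lemma cmult_add_left: "cmult (f + f') g = cmult f g + cmult f' g"
  by (auto simp: cmult_def fun_eq_iff algebra_simps split_def simp flip: sum.distrib)

lemma cmult_diff_right: "cmult f (g - g') = cmult f g - cmult f g'"
  for f :: "('n, 'k::comm_ring) coeffs"
  by (auto simp: cmult_def fun_eq_iff algebra_simps split_def simp flip: sum_subtractf)

lemma cmult_zero_left [simp]: "cmult 0 g = 0"
  by (auto simp: cmult_def fun_eq_iff intro!: sum.neutral)

text \<open>Fixing \<open>v = a\<close> forces \<open>u = b\<close> by cancellation, so one term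
  survives. Here \<open>a\<close> will be a leading exponent: first that of a factor with a single
  term, later that of an initial part at an extremal exponent.\<close>

lemma cmult_eq_single:
  fixes f g :: "('n::finite, 'k::comm_semiring_0) coeffs"
  assumes "\<And>u v. u + v = a + b \<Longrightarrow> u \<in> Exps f \<Longrightarrow> v \<in> Exps g \<Longrightarrow> v = a"
  shows "cmult f g (a + b) = f b * g a"
proof -
  have "cmult f g (a + b) = (\<Sum>(u, v)\<in>{(b, a)}. f u * g v)"
    unfolding cmult_def
  proof (rule sum.mono_neutral_right)
    show "\<forall>i\<in>{(u, v). u + v = a + b} - {(b, a)}. (case i of (u, v) \<Rightarrow> f u * g v) = 0"
    proof
      fix i assume i: "i \<in> {(u, v). u + v = a + b} - {(b, a)}"
      obtain u v where [simp]: "i = (u, v)" by (cases i)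
      have uv: "u + v = a + b" "(u, v) \<noteq> (b, a)" using i by simp_all
      have "f u * g v = 0"
      proof (rule ccontr)
        assume "f u * g v \<noteq> 0"
        then have "v = a" using assms[OF uv(1)] mult_not_zero unfolding Exps_def by blast
        then show False using uv by (simp add: add.commute)
      qed
      then show "(case i of (u, v) \<Rightarrow> f u * g v) = 0" by simp
    qed
  qed (auto simp: finite_splits add.commute)
  then show ?thesis by simp
qed

section \<open>The product of operators and its linearity in the left factor\<close>

lemma dmult_nonzeroE:
  assumes "dmult P Q w \<noteq> 0"
  obtains u v \<kappa> where "u \<in> Exps P" "v \<in> Exps Q" "\<kappa> \<le> xi_exp u" "\<kappa> \<le> x_exp v"
    "u + v = w + (\<kappa>, 0, \<kappa>)"
proof -
  obtain x where "x \<in> {(u, v, \<kappa>). u \<in> Exps P \<and> v \<in> Exps Q \<and>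
                         \<kappa> \<le> xi_exp u \<and> \<kappa> \<le> x_exp v \<and> u + v = w + (\<kappa>, 0, \<kappa>)}"
    using assms unfolding dmult_def by (rule sum.not_neutral_contains_not_neutral)
  then show thesis using that by auto
qed

lemma dmult_zero_left [simp]: "dmult 0 Q = 0"
  by (simp add: dmult_def fun_eq_iff)

lemma dmult_Dy:
  assumes "P \<in> Dy" "Q \<in> Dy"
  shows "dmult P Q \<in> Dy"
proof -
  obtain B C where "\<forall>u\<in>Exps P. total_deg u < B" "\<forall>u\<in>Exps Q. total_deg u < C"
    using assms Dy_iff_bounded by metis
  moreover have "\<exists>u\<in>Exps P. \<exists>v\<in>Exps Q. total_deg w \<le> total_deg u + total_deg v"
    if w: "w \<in> Exps (dmult P Q)" for w
  proof -
    obtain u v \<kappa> where "u \<in> Exps P" "v \<in> Exps Q" "u + v = w + (\<kappa>, 0, \<kappa>)"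
      using w by (auto simp: Exps_def elim: dmult_nonzeroE)
    then show ?thesis by (metis total_deg_add le_add1)
  qed
  ultimately have "\<forall>w\<in>Exps (dmult P Q). total_deg w < B + C"
    by (meson add_strict_mono le_less_trans)
  then show ?thesis by (auto simp: Dy_iff_bounded)
qed

text \<open>
  The binomials vanish unless \<open>\<kappa> \<le> xi_exp u\<close> and \<open>\<kappa> \<le> x_exp v\<close>, so the index set can be
  made independent of the supports; this makes linearity visible.
\<close>

lemma dmult_eq_nested_sum:
  fixes P Q :: "('n::finite, 'k::field_char_0) coeffs"
  assumes "finite K" and K: "\<And>u \<kappa>. u \<in> Exps P \<Longrightarrow> \<kappa> \<le> xi_exp u \<Longrightarrow> \<kappa> \<in> K"
  shows "dmult P Q w =
    (\<Sum>(\<kappa>, u, v) \<in> (SIGMA \<kappa>:K. {(u, v). u + v = w + (\<kappa>, 0, \<kappa>)}).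
       of_nat (\<Prod>i\<in>UNIV. fact (\<kappa> i) * (xi_exp u i choose \<kappa> i) * (x_exp v i choose \<kappa> i))
         * P u * Q v)"
proof -
  let ?A = "{(u, v, \<kappa>). u \<in> Exps P \<and> v \<in> Exps Q \<and>
                         \<kappa> \<le> xi_exp u \<and> \<kappa> \<le> x_exp v \<and> u + v = w + (\<kappa>, 0, \<kappa>)}"
  let ?S = "SIGMA \<kappa>:K. {(u, v). u + v = w + (\<kappa>, 0, \<kappa>)}"
  let ?h = "\<lambda>(\<kappa>, u, v). (u, v, \<kappa>)"
  let ?c = "\<lambda>u v \<kappa>. of_nat (\<Prod>i\<in>UNIV. fact (\<kappa> i) * (xi_exp u i choose \<kappa> i)
              * (x_exp v i choose \<kappa> i)) * P u * Q v"
  have "dmult P Q w = (\<Sum>(u, v, \<kappa>) \<in> ?h ` ?S. ?c u v \<kappa>)"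
    unfolding dmult_def
  proof (rule sum.mono_neutral_left)
    show "finite (?h ` ?S)"
      by (intro finite_imageI finite_SigmaI \<open>finite K\<close> finite_splits)
    show "?A \<subseteq> ?h ` ?S" using K by (force simp: image_iff)
    show "\<forall>x \<in> ?h ` ?S - ?A. (case x of (u, v, \<kappa>) \<Rightarrow> ?c u v \<kappa>) = 0"
    proof (intro ballI)
      fix x assume x: "x \<in> ?h ` ?S - ?A"
      obtain u v \<kappa> where [simp]: "x = (u, v, \<kappa>)" by (cases x)
      have "u \<notin> Exps P \<or> v \<notin> Exps Q \<or> \<not> \<kappa> \<le> xi_exp u \<or> \<not> \<kappa> \<le> x_exp v"
        using x by auto
      moreover have "?c u v \<kappa> = 0" if "xi_exp u i < \<kappa> i \<or> x_exp v i < \<kappa> i" for i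
      proof -
        have "fact (\<kappa> i) * (xi_exp u i choose \<kappa> i) * (x_exp v i choose \<kappa> i) = 0"
          using that by auto
        then have "(\<Prod>i\<in>UNIV. fact (\<kappa> i) * (xi_exp u i choose \<kappa> i) * (x_exp v i choose \<kappa> i)) = (0::nat)"
          by (intro prod_zero) auto
        then show ?thesis by (simp only: of_nat_0 mult_zero_left)
      qed
      ultimately have "?c u v \<kappa> = 0"
        unfolding le_fun_def not_all not_le by (auto simp: Exps_def)
      then show "(case x of (u, v, \<kappa>) \<Rightarrow> ?c u v \<kappa>) = 0" by simp
    qed
  qed
  also have "\<dots> = (\<Sum>(\<kappa>, u, v) \<in> ?S. ?c u v \<kappa>)"
    by (subst sum.reindex) (auto simp: inj_on_def split_def)
  finally show ?thesis .
qed

text \<open>A contraction is bounded by an exponent of \<xi>, and only finitely many of these occur,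
  although the exponents of x may be unbounded.\<close>

lemma Dhat_y_contractions:
  fixes P :: "('n::finite, 'k::zero) coeffs"
  assumes "P \<in> Dhat_y"
  shows "finite (\<Union>u\<in>Exps P. {\<kappa>. \<kappa> \<le> xi_exp u})"
proof -
  have "(\<Union>u\<in>Exps P. {\<kappa>. \<kappa> \<le> xi_exp u}) = (\<Union>s\<in>snd ` Exps P. {\<kappa>. \<kappa> \<le> snd s})"
    by (auto simp: xi_exp_def)
  moreover have "finite (snd ` Exps P)" using assms by (simp add: Dhat_y_def)
  ultimately show ?thesis
    by (simp only:) (intro finite_UN_I finite_fun_le)
qed

lemma dmult_add_left:
  assumes "P \<in> Dhat_y" "P' \<in> Dhat_y"
  shows "dmult (P + P') Q = dmult P Q + dmult P' Q"
proof
  fix w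
  \<comment> \<open>One finite set of contractions serves both summands and their sum, so the three
    products become sums over the same indices.\<close>
  let ?K = "(\<Union>u\<in>Exps P. {\<kappa>. \<kappa> \<le> xi_exp u}) \<union> (\<Union>u\<in>Exps P'. {\<kappa>. \<kappa> \<le> xi_exp u})"
  have fin: "finite ?K" using assms Dhat_y_contractions by blast
  have K: "\<And>R u \<kappa>. Exps R \<subseteq> Exps P \<union> Exps P' \<Longrightarrow> u \<in> Exps R \<Longrightarrow> \<kappa> \<le> xi_exp u \<Longrightarrow> \<kappa> \<in> ?K"
    by blast
  note nested = dmult_eq_nested_sum[OF fin K, where Q = Q and w = w]
  show "dmult (P + P') Q w = (dmult P Q + dmult P' Q) w"
    by (simp only: plus_fun_apply nested[OF Exps_add] nested[OF Un_upper1] nested[OF Un_upper2]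
          flip: sum.distrib)
      (simp add: algebra_simps split_def)
qed

lemma dmult_diff_left:
  assumes "P \<in> Dhat_y" "P' \<in> Dhat_y"
  shows "dmult (P - P') Q = dmult P Q - dmult P' Q"
proof -
  have "dmult P Q = dmult (P - P') Q + dmult P' Q"
    using dmult_add_left[OF Dhat_y_diff[OF assms] assms(2)] by simp
  then show ?thesis by (simp add: algebra_simps)
qed

section \<open>Initial parts, and the operator product in top weight\<close>

lemma e_weight_le_ord_e: "Q \<in> Dy \<Longrightarrow> v \<in> Exps Q \<Longrightarrow> e_weight v \<le> ord_e Q"
  by (auto simp: ord_e_def Dy_def)

lemma Exps_in_e: "Exps (in_e P) = {u \<in> Exps P. e_weight u = ord_e P}"
  by (auto simp: Exps_def in_e_def)

lemma in_e_Dy: "P \<in> Dy \<Longrightarrow> in_e P \<in> Dy"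
  by (erule Dy_subset) (auto simp: Exps_in_e)

text \<open>Weights balance as
  \<open>e_weight u + e_weight v = e_weight w + sum \<kappa> UNIV\<close>, while \<open>low\<close>
  caps the left side at \<open>e_weight w\<close>. Hence \<open>\<kappa> = 0\<close> and
  \<open>v\<close> has top weight: neither the contractions nor the lower terms of \<open>Q\<close>
  contribute at \<open>w\<close>.\<close>

lemma dmult_eq_cmult_in_e:
  fixes P Q :: "('n::finite, 'k::field_char_0) coeffs"
  assumes "Q \<in> Dy"
    and low: "\<And>u v \<kappa>. u \<in> Exps P \<Longrightarrow> v \<in> Exps Q \<Longrightarrow> \<kappa> \<le> x_exp v \<Longrightarrow> u + v = w + (\<kappa>, 0, \<kappa>) \<Longrightarrow>
      e_weight u + ord_e Q \<le> e_weight w"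
  shows "dmult P Q w = cmult P (in_e Q) w"
proof -
  let ?A = "{(u, v, \<kappa>). u \<in> Exps P \<and> v \<in> Exps Q \<and>
                         \<kappa> \<le> xi_exp u \<and> \<kappa> \<le> x_exp v \<and> u + v = w + (\<kappa>, 0, \<kappa>)}"
  let ?S = "{(u, v). u \<in> Exps P \<and> v \<in> Exps (in_e Q) \<and> u + v = w}"
  have key: "\<kappa> = 0 \<and> e_weight v = ord_e Q"
    if "u \<in> Exps P" "v \<in> Exps Q" "\<kappa> \<le> x_exp v" "u + v = w + (\<kappa>, 0, \<kappa>)" for u v \<kappa>
  proof -
    have "e_weight u + e_weight v = e_weight w + sum \<kappa> UNIV"
      using that(4) by (metis e_weight_add e_weight_contraction)
    moreover have "e_weight v \<le> ord_e Q" using assms(1) that(2) by (rule e_weight_le_ord_e)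
    ultimately have "sum \<kappa> UNIV = 0" "e_weight v = ord_e Q"
      using low[OF that] by linarith+
    then show ?thesis by (auto simp: fun_eq_iff)
  qed
  have zero: "(0, 0, 0) = (0 :: 'n expo)" by (simp add: zero_prod_def)
  have A: "?A = (\<lambda>(u, v). (u, v, 0)) ` ?S"
  proof (intro subset_antisym subsetI)
    fix x assume x: "x \<in> ?A"
    obtain u v \<kappa> where [simp]: "x = (u, v, \<kappa>)" by (cases x)
    have "\<kappa> = 0 \<and> e_weight v = ord_e Q" using x key[of u v \<kappa>] by simp
    then have "(u, v) \<in> ?S" "x = (u, v, 0)" using x by (simp_all add: Exps_in_e zero)
    then show "x \<in> (\<lambda>(u, v). (u, v, 0)) ` ?S" by (intro image_eqI[of _ _ "(u, v)"]) simp_all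
  next
    fix x :: "'n expo \<times> 'n expo \<times> ('n \<Rightarrow> nat)"
    assume "x \<in> (\<lambda>(u, v). (u, v, 0)) ` ?S"
    then obtain u v where "(u, v) \<in> ?S" and [simp]: "x = (u, v, 0)" by fast
    then show "x \<in> ?A" by (simp add: Exps_in_e zero le_fun_def)
  qed
  have "dmult P Q w = (\<Sum>(u, v) \<in> ?S. P u * Q v)"
    unfolding dmult_def A by (subst sum.reindex) (auto simp: inj_on_def split_def)
  also have "\<dots> = (\<Sum>(u, v) \<in> ?S. P u * in_e Q v)"
    by (rule sum.cong) (auto simp: Exps_in_e, auto simp: in_e_def)
  also have "\<dots> = cmult P (in_e Q) w"
    unfolding cmult_def
    by (rule sum.mono_neutral_left) (auto simp: finite_splits Exps_def)
  finally show ?thesis .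
qed

section \<open>Leading exponents\<close>

lemma LE_eqI:
  assumes "asymp lt" "u \<in> Exps P" "\<And>v. v \<in> Exps P \<Longrightarrow> v \<noteq> u \<Longrightarrow> lt v u"
  shows "LE lt P = u"
  unfolding LE_def
proof (rule the_equality)
  fix u' assume u': "u' \<in> Exps P \<and> (\<forall>v\<in>Exps P. v \<noteq> u' \<longrightarrow> lt v u')"
  show "u' = u"
  proof (rule ccontr)
    assume "u' \<noteq> u"
    then have "lt u u'" "lt u' u" using u' assms(2,3) by metis+
    then show False using asympD[OF assms(1)] by metis
  qed
qed (use assms in simp)

text \<open>A nonempty finite support has a greatest element under a total transitive order, and
  asymmetry makes it the only one, so the definite description in \<open>LE\<close> denotes
  it.\<close>

lemma LE_greatest:
  assumes "transp lt" "totalp lt" "asymp lt" "P \<in> Dy" "P \<noteq> 0"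
  shows "LE lt P \<in> Exps P" and "\<And>v. v \<in> Exps P \<Longrightarrow> v \<noteq> LE lt P \<Longrightarrow> lt v (LE lt P)"
proof -
  have "\<exists>g\<in>Exps P. \<forall>x\<in>Exps P. x \<noteq> g \<longrightarrow> lt x g"
    using assms by (intro Finite_Set.bex_greatest_element)
      (auto simp: Dy_def Exps_eq_empty_iff intro: transp_on_subset totalp_on_subset)
  then obtain g where g: "g \<in> Exps P" "\<And>x. x \<in> Exps P \<Longrightarrow> x \<noteq> g \<Longrightarrow> lt x g" by blast
  have "LE lt P = g" using \<open>asymp lt\<close> g by (rule LE_eqI)
  then show "LE lt P \<in> Exps P" "\<And>v. v \<in> Exps P \<Longrightarrow> v \<noteq> LE lt P \<Longrightarrow> lt v (LE lt P)"
    using g by auto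
qed

lemma term_order_asymp: "term_order lt \<Longrightarrow> asymp lt"
  by (auto simp: term_order_def intro: wfp_imp_asymp)

lemma less_r_order:
  assumes "term_order lt\<^sub>1"
  shows "transp (less_r lt\<^sub>1)" "totalp (less_r lt\<^sub>1)" "asymp (less_r lt\<^sub>1)"
    and "less_r lt\<^sub>1 u v \<Longrightarrow> less_r lt\<^sub>1 (u + w) (v + w)"
proof -
  note lt = assms[unfolded term_order_def] and asym = asympD[OF term_order_asymp[OF assms]]
  have add: "lt\<^sub>1 u v \<Longrightarrow> lt\<^sub>1 (u + w) (v + w)" using lt by metis
  show "transp (less_r lt\<^sub>1)"
    using lt by (auto intro!: transpI simp: less_r_def dest: transpD)
  show "totalp (less_r lt\<^sub>1)"
    using lt by (intro totalpI) (metis less_r_def linorder_neqE_nat totalpD)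
  show "asymp (less_r lt\<^sub>1)"
    using asym by (intro asympI) (auto simp: less_r_def)
  show "less_r lt\<^sub>1 u v \<Longrightarrow> less_r lt\<^sub>1 (u + w) (v + w)"
    using add unfolding less_r_def by (simp only: total_deg_add add_less_cancel_right add_right_cancel) blast
qed

lemma less_e_order:
  assumes "term_order lt\<^sub>1"
  shows "transp (less_e lt\<^sub>1)" "totalp (less_e lt\<^sub>1)" "asymp (less_e lt\<^sub>1)"
proof -
  note lt = assms[unfolded term_order_def] and asym = asympD[OF term_order_asymp[OF assms]]
  show "transp (less_e lt\<^sub>1)"
    using lt by (auto intro!: transpI simp: less_e_def dest: transpD)
  show "totalp (less_e lt\<^sub>1)"
    using lt by (intro totalpI) (metis less_e_def linorder_neqE_nat totalpD)
  show "asymp (less_e lt\<^sub>1)"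
    using asym by (intro asympI) (auto simp: less_e_def)
qed

lemma e_weight_LE:
  assumes "term_order lt\<^sub>1" "P \<in> Dy" "P \<noteq> 0"
  shows "e_weight (LE (less_e lt\<^sub>1) P) = ord_e P"
proof -
  note LE = LE_greatest[OF less_e_order[OF assms(1)] assms(2,3)]
  have "e_weight v \<le> e_weight (LE (less_e lt\<^sub>1) P)" if "v \<in> Exps P" for v
    using LE(2)[OF that] by (cases "v = LE (less_e lt\<^sub>1) P") (auto simp: less_e_def)
  then show ?thesis
    unfolding ord_e_def using LE(1) \<open>P \<in> Dy\<close>
    by (intro Max_eqI[symmetric]) (auto simp: Dy_def)
qed

text \<open>By \<open>total_deg_eq\<close>, at fixed weight a smaller \<open>x_deg\<close> means a
  smaller \<open>total_deg\<close>, and both orders break ties by \<open>lt\<^sub>1\<close>. The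
  terms of lower weight, absent from \<open>in_e P\<close>, do not compete for the lead.\<close>

lemma LE_in_e:
  assumes "term_order lt\<^sub>1" "P \<in> Dy" "P \<noteq> 0"
  shows "LE (less_r lt\<^sub>1) (in_e P) = LE (less_e lt\<^sub>1) P"
proof (rule LE_eqI)
  note LE = LE_greatest[OF less_e_order[OF assms(1)] assms(2,3)]
  show "asymp (less_r lt\<^sub>1)" using assms(1) by (rule less_r_order)
  show "LE (less_e lt\<^sub>1) P \<in> Exps (in_e P)"
    using LE(1) e_weight_LE[OF assms] by (simp add: Exps_in_e)
  fix v assume "v \<in> Exps (in_e P)" "v \<noteq> LE (less_e lt\<^sub>1) P"
  then show "less_r lt\<^sub>1 v (LE (less_e lt\<^sub>1) P)"
    using LE(2)[of v] e_weight_LE[OF assms]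
    by (auto simp: Exps_in_e less_e_def less_r_def total_deg_eq)
qed

lemma in_e_nonzero:
  assumes "P \<in> Dy" "P \<noteq> 0"
  shows "in_e P \<noteq> 0"
proof -
  have "ord_e P \<in> e_weight ` Exps P"
    unfolding ord_e_def using assms by (intro Max_in) (auto simp: Dy_def Exps_eq_empty_iff)
  then obtain u where "u \<in> Exps P" "e_weight u = ord_e P" by (metis imageE)
  then have "u \<in> Exps (in_e P)" by (simp add: Exps_in_e)
  then show ?thesis by (metis Exps_zero empty_iff)
qed

section \<open>The partition\<close>

lemma Delta_subset: "Delta as i \<subseteq> expo_cone (as ! i)"
  by (subst Delta.simps) auto

text \<open>Of two pieces, the one with the larger index is formed by removing the other.\<close>

lemma Delta_inj:
  assumes "w \<in> Delta as i" "w \<in> Delta as j"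
  shows "i = j"
proof -
  have "\<not> i < j" if "w \<in> Delta as i" "w \<in> Delta as j" for i j
    using that(1) that(2)[unfolded Delta.simps[of as j]] by auto
  then show ?thesis using assms linorder_neqE_nat by metis
qed

lemma Delta_bar_disjoint: "w \<in> Delta_bar as \<Longrightarrow> i < length as \<Longrightarrow> w \<notin> Delta as i"
  by (auto simp: Delta_bar_def)

text \<open>Think of \<open>f j\<close> as the coefficient at \<open>w\<close> of the product with
  index \<open>j\<close>. Disjointness leaves at most one nonzero summand; this separates the
  products both in the division by leading terms and in the final comparison.\<close>

lemma sum_on_partition:
  assumes "\<And>j. j < length as \<Longrightarrow> f j \<noteq> 0 \<Longrightarrow> w \<in> Delta as j"
  shows "i < length as \<Longrightarrow> w \<in> Delta as i \<Longrightarrow> (\<Sum>j<length as. f j) = f i"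
    and "w \<in> Delta_bar as \<Longrightarrow> (\<Sum>j<length as. f j) = 0"
proof -
  assume i: "i < length as" "w \<in> Delta as i"
  have "(\<Sum>j<length as. f j) = (\<Sum>j\<in>{i}. f j)"
  proof (rule sum.mono_neutral_right)
    show "\<forall>j\<in>{..<length as} - {i}. f j = 0"
      using assms Delta_inj[OF i(2)] by blast
  qed (use i in simp_all)
  then show "(\<Sum>j<length as. f j) = f i" by simp
next
  assume "w \<in> Delta_bar as"
  then show "(\<Sum>j<length as. f j) = 0"
    using assms Delta_bar_disjoint by (intro sum.neutral) blast
qed

section \<open>Division by leading terms\<close>

lemma Exps_LT: "Exps (LT lt g) \<subseteq> {LE lt g}"
  unfolding Exps_def LT_def by (rule subsetI) (simp split: if_splits)

lemma Exps_Rest: "Exps (Rest lt g) = Exps g - {LE lt g}"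
  for g :: "('n, 'k::ab_group_add) coeffs"
  unfolding Exps_def Rest_def LT_def by (rule set_eqI) simp

lemma cmult_LT_coeff:
  fixes q :: "('n::finite, 'k::comm_semiring_0) coeffs"
  shows "cmult q (LT lt g) (LE lt g + u) = q u * g (LE lt g)"
proof -
  have "cmult q (LT lt g) (LE lt g + u) = q u * LT lt g (LE lt g)"
  proof (rule cmult_eq_single)
    fix u v assume "v \<in> Exps (LT lt g)"
    then show "v = LE lt g" using Exps_LT by fast
  qed
  then show ?thesis by (simp add: LT_def)
qed

lemma cmult_LT_nonzero:
  assumes "cmult q (LT lt g) w \<noteq> 0"
  shows "w \<in> (\<lambda>u. LE lt g + u) ` Exps q"
  using assms
proof (rule cmult_nonzeroE)
  fix u v assume uv: "u + v = w" "u \<in> Exps q" "v \<in> Exps (LT lt g)"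
  have "v = LE lt g" using subsetD[OF Exps_LT uv(3)] by simp
  then have "w = LE lt g + u" using uv(1) by (simp add: add.commute)
  then show ?thesis using uv(2) by (rule image_eqI)
qed

lemma is_LT_divisionD:
  assumes "is_LT_division lt F gs qs r"
  shows "length qs = length gs" "i < length gs \<Longrightarrow> qs ! i \<in> Dy" "r \<in> Dy"
    and "F = (\<Sum>i<length gs. cmult (qs ! i) (LT lt (gs ! i))) + r"
    and "i < length gs \<Longrightarrow> u \<in> Exps (qs ! i) \<Longrightarrow> LE lt (gs ! i) + u \<in> Delta (map (LE lt) gs) i"
    and "w \<in> Exps r \<Longrightarrow> w \<in> Delta_bar (map (LE lt) gs)"
proof -
  note div = assms[unfolded is_LT_division_def]
  show *: "length qs = length gs" and "r \<in> Dy"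
    and "F = (\<Sum>i<length gs. cmult (qs ! i) (LT lt (gs ! i))) + r"
    using div by simp_all
  show "qs ! i \<in> Dy" if "i < length gs"
    using div * that by (simp add: subset_code(1))
  show "LE lt (gs ! i) + u \<in> Delta (map (LE lt) gs) i" if "i < length gs" "u \<in> Exps (qs ! i)"
    using div that by (simp add: image_subset_iff)
  show "w \<in> Delta_bar (map (LE lt) gs)" if "w \<in> Exps r"
    using div that by (blast intro: subsetD)
qed

text \<open>Multiplying by a leading term shifts the support and scales it. The shifted quotients
  and the remainder lie in disjoint pieces, so each coefficient of \<open>F\<close> determines a
  single coefficient of the result.\<close>

lemma is_LT_division_coeffs:
  fixes gs :: "('n::finite, 'k::field_char_0) coeffs list"
  assumes "is_LT_division lt F gs qs r"
  shows "i < length gs \<Longrightarrow> LE lt (gs ! i) + u \<in> Delta (map (LE lt) gs) i \<Longrightarrow>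
      F (LE lt (gs ! i) + u) = (qs ! i) u * (gs ! i) (LE lt (gs ! i))"
    and "w \<in> Delta_bar (map (LE lt) gs) \<Longrightarrow> F w = r w"
proof -
  let ?as = "map (LE lt) gs"
  note div = is_LT_divisionD[OF assms]
  have F: "F w = (\<Sum>j<length ?as. cmult (qs ! j) (LT lt (gs ! j)) w) + r w" for w
    by (subst div(4)) (simp add: sum_fun_apply)
  have D: "w \<in> Delta ?as j" if w: "j < length ?as" "cmult (qs ! j) (LT lt (gs ! j)) w \<noteq> 0" for j w
  proof -
    obtain u where u: "w = LE lt (gs ! j) + u" "u \<in> Exps (qs ! j)"
      using cmult_LT_nonzero[OF w(2)] by (rule imageE)
    show ?thesis unfolding u(1) by (rule div(5)) (use w u in simp_all)
  qed
  note S = sum_on_partition[where as = ?as, OF D]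
  show "F (LE lt (gs ! i) + u) = (qs ! i) u * (gs ! i) (LE lt (gs ! i))"
    if i: "i < length gs" "LE lt (gs ! i) + u \<in> Delta ?as i"
  proof -
    have "LE lt (gs ! i) + u \<notin> Exps r"
      using div(6) Delta_bar_disjoint[of _ ?as i] i unfolding length_map by metis
    then have "r (LE lt (gs ! i) + u) = 0" by (simp add: Exps_def)
    moreover have "(\<Sum>j<length ?as. cmult (qs ! j) (LT lt (gs ! j)) (LE lt (gs ! i) + u)) =
        cmult (qs ! i) (LT lt (gs ! i)) (LE lt (gs ! i) + u)"
      by (rule S(1)) (use i in simp_all)
    ultimately show ?thesis by (simp only: F cmult_LT_coeff add_0_right)
  qed
  show "F w = r w" if "w \<in> Delta_bar ?as"
  proof -
    have "(\<Sum>j<length ?as. cmult (qs ! j) (LT lt (gs ! j)) w) = 0"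
      by (rule S(2)) (use that in simp_all)
    then show ?thesis by (simp only: F add_0_left)
  qed
qed

text \<open>A nonzero quotient coefficient times the nonzero leading coefficient is a coefficient of
  \<open>F\<close>. This carries the weight of \<open>F\<close> and the bound by its leading
  exponent over to the quotients.\<close>

lemma is_LT_division_support:
  fixes gs :: "('n::finite, 'k::field_char_0) coeffs list"
  assumes "is_LT_division lt F gs qs r"
    and lead: "\<And>g. g \<in> set gs \<Longrightarrow> LE lt g \<in> Exps g"
    and "i < length gs" "u \<in> Exps (qs ! i)"
  shows "LE lt (gs ! i) + u \<in> Exps F"
proof -
  have "LE lt (gs ! i) + u \<in> Delta (map (LE lt) gs) i"
    by (rule is_LT_divisionD) fact+
  then show ?thesis
    using is_LT_division_coeffs(1)[OF assms(1,3)] lead[of "gs ! i"] assms(3,4)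
    by (simp add: Exps_def)
qed

lemma is_LT_division_unique:
  fixes gs :: "('n::finite, 'k::field_char_0) coeffs list"
  assumes div: "is_LT_division lt F gs qs r" "is_LT_division lt F gs qs' r'"
    and lead: "\<And>g. g \<in> set gs \<Longrightarrow> LE lt g \<in> Exps g"
  shows "qs' = qs" "r' = r"
proof -
  show "qs' = qs"
  proof (rule nth_equalityI)
    show "length qs' = length qs" using div by (simp add: is_LT_division_def)
    fix i assume "i < length qs'"
    then have i: "i < length gs" using div by (simp add: is_LT_division_def)
    show "qs' ! i = qs ! i"
    proof
      fix u
      let ?w = "LE lt (gs ! i) + u"
      show "(qs' ! i) u = (qs ! i) u"
      proof (cases "?w \<in> Delta (map (LE lt) gs) i")
        case True
        then have "(qs' ! i) u * (gs ! i) (LE lt (gs ! i)) = (qs ! i) u * (gs ! i) (LE lt (gs ! i))"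
          by (simp only: is_LT_division_coeffs(1)[OF div(1) i True, symmetric]
              is_LT_division_coeffs(1)[OF div(2) i True, symmetric])
        then show ?thesis using lead[of "gs ! i"] i by (simp add: Exps_def)
      next
        case False
        then have "u \<notin> Exps (qs ! i)" "u \<notin> Exps (qs' ! i)"
          using is_LT_divisionD(5)[OF div(1) i] is_LT_divisionD(5)[OF div(2) i] by metis+
        then show ?thesis by (simp add: Exps_def)
      qed
    qed
  qed
  show "r' = r"
  proof
    fix w
    show "r' w = r w"
    proof (cases "w \<in> Delta_bar (map (LE lt) gs)")
      case True
      then show ?thesis
        using is_LT_division_coeffs(2)[OF div(1)] is_LT_division_coeffs(2)[OF div(2)] by simp
    next
      case False
      then have "w \<notin> Exps r" "w \<notin> Exps r'"
        using is_LT_divisionD(6)[OF div(1)] is_LT_divisionD(6)[OF div(2)] by metis+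
      then show ?thesis by (simp add: Exps_def)
    qed
  qed
qed

lemma is_LT_division_exists:
  fixes gs :: "('n::finite, 'k::field_char_0) coeffs list"
  assumes "F \<in> Dy" and lead: "\<And>g. g \<in> set gs \<Longrightarrow> LE lt g \<in> Exps g"
  shows "\<exists>qs r. is_LT_division lt F gs qs r"
proof -
  let ?as = "map (LE lt) gs"
  \<comment> \<open>These are the formulas forced by \<open>is_LT_division_coeffs\<close>: a
    coefficient of \<open>F\<close> in the piece with index \<open>i\<close> is divided by the
    leading coefficient, and one in \<open>Delta_bar\<close> goes to the remainder.\<close>
  define q where "q i = (\<lambda>u. if LE lt (gs ! i) + u \<in> Delta ?as i
      then F (LE lt (gs ! i) + u) / (gs ! i) (LE lt (gs ! i)) else 0)" for i
  define r where "r = (\<lambda>w. if w \<in> Delta_bar ?as then F w else 0)"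
  have Exps_q: "LE lt (gs ! i) + u \<in> Delta ?as i" "LE lt (gs ! i) + u \<in> Exps F"
    if "u \<in> Exps (q i)" for u i
    using that by (simp_all add: Exps_def q_def split: if_splits)
  have "q i \<in> Dy" for i
  proof -
    have "(\<lambda>u. LE lt (gs ! i) + u) ` Exps (q i) \<subseteq> Exps F"
      by (rule image_subsetI) (simp add: Exps_q)
    then have "finite ((\<lambda>u. LE lt (gs ! i) + u) ` Exps (q i))"
      using \<open>F \<in> Dy\<close> finite_subset by (auto simp: Dy_def)
    then show ?thesis unfolding Dy_def by (simp add: finite_image_iff)
  qed
  moreover have "r \<in> Dy"
    using \<open>F \<in> Dy\<close> by (rule Dy_subset) (auto simp: r_def Exps_def)
  moreover have "Exps r \<subseteq> Delta_bar ?as"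
    by (rule subsetI) (simp add: r_def Exps_def split: if_splits)
  moreover have "F = (\<Sum>i<length gs. cmult (q i) (LT lt (gs ! i))) + r"
  proof
    fix w
    have D: "w \<in> Delta ?as j" if "cmult (q j) (LT lt (gs ! j)) w \<noteq> 0" for j
      using cmult_LT_nonzero[OF that] by (rule imageE) (simp add: Exps_q)
    note S = sum_on_partition[where as = ?as and f = "\<lambda>j. cmult (q j) (LT lt (gs ! j)) w", OF D,
        unfolded length_map]
    have "F w = (\<Sum>i<length gs. cmult (q i) (LT lt (gs ! i)) w) + r w"
    proof (cases "w \<in> Delta_bar ?as")
      case True
      then show ?thesis using S(2) by (simp add: r_def)
    next
      case False
      then obtain i where i: "i < length gs" "w \<in> Delta ?as i"
        by (auto simp: Delta_bar_def)
      then obtain u where u: "w = LE lt (gs ! i) + u"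
        using subsetD[OF Delta_subset i(2)] i(1) by (simp add: expo_cone_def image_iff) blast
      have "cmult (q i) (LT lt (gs ! i)) w = F w"
        using lead[of "gs ! i"] i by (simp add: u cmult_LT_coeff q_def Exps_def)
      then show ?thesis using S(1)[OF _ i] False by (simp add: r_def)
    qed
    then show "F w = ((\<Sum>i<length gs. cmult (q i) (LT lt (gs ! i))) + r) w"
      by (simp add: sum_fun_apply)
  qed
  moreover have "(\<lambda>u. LE lt (gs ! i) + u) ` Exps (q i) \<subseteq> Delta ?as i" for i
    by (rule image_subsetI) (rule Exps_q)
  ultimately have "is_LT_division lt F gs (map q [0..<length gs]) r"
    unfolding is_LT_division_def by (simp add: image_subset_iff)
  then show ?thesis by blast
qed

text \<open>Existence and uniqueness together give the definite description in
  \<open>LT_division\<close> its meaning.\<close>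

lemma is_LT_division_LT_division:
  fixes gs :: "('n::finite, 'k::field_char_0) coeffs list"
  assumes "F \<in> Dy" "\<And>g. g \<in> set gs \<Longrightarrow> LE lt g \<in> Exps g"
    and "LT_division lt F gs = (qs, r)"
  shows "is_LT_division lt F gs qs r"
proof -
  obtain qs0 r0 where *: "is_LT_division lt F gs qs0 r0"
    using is_LT_division_exists[of F gs lt] assms(1,2) by blast
  have "LT_division lt F gs = (qs0, r0)"
    unfolding LT_division_def
  proof (rule the_equality)
    fix x assume x: "case x of (qs, r) \<Rightarrow> is_LT_division lt F gs qs r"
    obtain qs1 r1 where [simp]: "x = (qs1, r1)" by (cases x)
    have "is_LT_division lt F gs qs1 r1" using x by simp
    then have "qs1 = qs0" "r1 = r0" using is_LT_division_unique[OF * _ assms(2)] by simp_all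
    then show "x = (qs0, r0)" by simp
  qed (simp add: *)
  then show ?thesis using * assms(3) by simp
qed

section \<open>Commutative approximate division\<close>

text \<open>The loop keeps \<open>F\<close> as an explicit error in the division identity. The last
  two conditions record homogeneity: what is still to be divided has weight \<open>k\<close>, and so
  has every quotient term times its leading term.\<close>

definition Kx_invariant ::
  "('n::finite expo \<Rightarrow> 'n expo \<Rightarrow> bool) \<Rightarrow> ('n, 'k::field_char_0) coeffs \<Rightarrow> ('n, 'k) coeffs list \<Rightarrow>
   nat \<Rightarrow> ('n, 'k) coeffs list \<times> ('n, 'k) coeffs \<times> ('n, 'k) coeffs \<Rightarrow> bool"
where
  "Kx_invariant lt f gs k = (\<lambda>(qs, r, F).
     length qs = length gs \<and> set qs \<subseteq> Dy \<and> r \<in> Dy \<and> F \<in> Dy \<and>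
     f = (\<Sum>i<length gs. cmult (qs ! i) (gs ! i)) + r + F \<and>
     (\<forall>i<length gs. (\<lambda>u. LE lt (gs ! i) + u) ` Exps (qs ! i) \<subseteq> Delta (map (LE lt) gs) i) \<and>
     Exps r \<subseteq> Delta_bar (map (LE lt) gs) \<and>
     (\<forall>u\<in>Exps F. e_weight u = k) \<and>
     (\<forall>i<length gs. \<forall>u\<in>Exps (qs ! i). e_weight u + e_weight (LE lt (gs ! i)) = k))"

lemma Kx_invariantD:
  assumes "Kx_invariant lt f gs k (qs, r, F)"
  shows "length qs = length gs" "set qs \<subseteq> Dy" "r \<in> Dy" "F \<in> Dy"
    and "f = (\<Sum>i<length gs. cmult (qs ! i) (gs ! i)) + r + F"
    and "i < length gs \<Longrightarrow> u \<in> Exps (qs ! i) \<Longrightarrow> LE lt (gs ! i) + u \<in> Delta (map (LE lt) gs) i"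
    and "w \<in> Exps r \<Longrightarrow> w \<in> Delta_bar (map (LE lt) gs)"
    and "w \<in> Exps F \<Longrightarrow> e_weight w = k"
    and "i < length gs \<Longrightarrow> u \<in> Exps (qs ! i) \<Longrightarrow> e_weight u + e_weight (LE lt (gs ! i)) = k"
proof -
  note inv = assms[unfolded Kx_invariant_def split]
  show "length qs = length gs" "set qs \<subseteq> Dy" "r \<in> Dy" "F \<in> Dy"
    "f = (\<Sum>i<length gs. cmult (qs ! i) (gs ! i)) + r + F"
    using inv by simp_all
  show "LE lt (gs ! i) + u \<in> Delta (map (LE lt) gs) i" if "i < length gs" "u \<in> Exps (qs ! i)"
    using inv that by (simp add: image_subset_iff)
  show "w \<in> Delta_bar (map (LE lt) gs)" if "w \<in> Exps r"
    using inv that by (blast intro: subsetD)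
  show "e_weight w = k" if "w \<in> Exps F" using inv that by blast
  show "e_weight u + e_weight (LE lt (gs ! i)) = k" if "i < length gs" "u \<in> Exps (qs ! i)"
    using inv that by blast
qed

lemma set_map2_add_Dy:
  fixes Qs Qs' :: "('n, 'k::monoid_add) coeffs list"
  assumes "set Qs \<subseteq> Dy" "set Qs' \<subseteq> Dy"
  shows "set (map2 (+) Qs Qs') \<subseteq> Dy"
proof
  fix Q assume "Q \<in> set (map2 (+) Qs Qs')"
  then obtain A B where AB: "(A, B) \<in> set (zip Qs Qs')" "Q = A + B" by fastforce
  then have "A \<in> Dy" "B \<in> Dy"
    using set_zip_leftD[OF AB(1)] set_zip_rightD[OF AB(1)] assms by (simp_all add: subset_iff)
  then show "Q \<in> Dy" unfolding AB(2) by (rule Dy_add)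
qed

text \<open>A new term is \<open>u + v\<close> with \<open>u\<close> in a quotient and
  \<open>v\<close> a lower term of some \<open>g\<close>. It lies strictly below
  \<open>LE lt g + u\<close>, which is an exponent of \<open>F\<close> and thus at most
  \<open>LE lt F\<close>; homogeneity of \<open>g\<close> preserves the weight.\<close>

lemma Kx_step:
  fixes gs :: "('n::finite, 'k::field_char_0) coeffs list"
  assumes ord: "transp lt" "totalp lt" "asymp lt"
      "\<And>u v w. lt u v \<Longrightarrow> lt (u + w) (v + w)"
    and gs: "\<And>g. g \<in> set gs \<Longrightarrow> g \<in> Dy \<and> g \<noteq> 0"
    and hom: "\<And>g u. g \<in> set gs \<Longrightarrow> u \<in> Exps g \<Longrightarrow> e_weight u = e_weight (LE lt g)"
    and inv: "Kx_invariant lt f gs k (qs, r, F)"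
    and "F \<noteq> 0"
    and div: "is_LT_division lt F gs qs' r'"
  defines "F' \<equiv> - (\<Sum>i<length gs. cmult (qs' ! i) (Rest lt (gs ! i)))"
  shows "Kx_invariant lt f gs k (map2 (+) qs qs', r + r', F')"
    and "\<forall>w\<in>Exps F'. lt w (LE lt F)"
proof -
  note inv = Kx_invariantD[OF inv] and div' = is_LT_divisionD[OF div]
  note lq = inv(1) and lq' = div'(1)
  have lead: "LE lt g \<in> Exps g" "\<And>v. v \<in> Exps g \<Longrightarrow> v \<noteq> LE lt g \<Longrightarrow> lt v (LE lt g)"
    if "g \<in> set gs" for g
    using LE_greatest[OF ord(1-3), of g] gs[OF that] by blast+
  have supp: "LE lt (gs ! i) + u \<in> Exps F" if "i < length gs" "u \<in> Exps (qs' ! i)" for i u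
    by (rule is_LT_division_support[OF div lead(1) that])
  have weight': "e_weight u + e_weight (LE lt (gs ! i)) = k"
    if "i < length gs" "u \<in> Exps (qs' ! i)" for i u
    using inv(8)[OF supp[OF that]] by simp
  have Exps_F': "\<exists>i u v. i < length gs \<and> u \<in> Exps (qs' ! i) \<and> v \<in> Exps (gs ! i) \<and>
      v \<noteq> LE lt (gs ! i) \<and> w = u + v" if w: "w \<in> Exps F'" for w
  proof -
    have "w \<in> Exps (\<Sum>i<length gs. cmult (qs' ! i) (Rest lt (gs ! i)))"
      using w by (simp add: F'_def)
    then have "w \<in> (\<Union>i<length gs. Exps (cmult (qs' ! i) (Rest lt (gs ! i))))"
      by (rule subsetD[OF Exps_sum])
    then obtain i where i: "i < length gs" "cmult (qs' ! i) (Rest lt (gs ! i)) w \<noteq> 0"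
      unfolding Exps_def by blast
    show ?thesis
      using i(2)
    proof (rule cmult_nonzeroE)
      fix u v assume "u + v = w" "u \<in> Exps (qs' ! i)" "v \<in> Exps (Rest lt (gs ! i))"
      then show ?thesis using i(1) unfolding Exps_Rest by blast
    qed
  qed
  show "\<forall>w\<in>Exps F'. lt w (LE lt F)"
  proof
    fix w assume "w \<in> Exps F'"
    then obtain i u v where i: "i < length gs" and u: "u \<in> Exps (qs' ! i)"
      and v: "v \<in> Exps (gs ! i)" "v \<noteq> LE lt (gs ! i)" and w: "w = u + v"
      using Exps_F' by blast
    have "lt v (LE lt (gs ! i))" using lead(2)[OF nth_mem[OF i] v] .
    then have less: "lt w (LE lt (gs ! i) + u)"
      using ord(4)[of v "LE lt (gs ! i)" u] by (simp only: w add.commute)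
    show "lt w (LE lt F)"
    proof (cases "LE lt (gs ! i) + u = LE lt F")
      case True
      then show ?thesis using less by simp
    next
      case False
      then have "lt (LE lt (gs ! i) + u) (LE lt F)"
        by (rule LE_greatest(2)[OF ord(1-3) inv(4) \<open>F \<noteq> 0\<close> supp[OF i u]])
      then show ?thesis by (rule transpD[OF ord(1) less])
    qed
  qed
  have "F' \<in> Dy"
    unfolding F'_def
  proof (intro Dy_uminus Dy_sum cmult_Dy)
    fix i assume "i \<in> {..<length gs}"
    then have i: "i < length gs" by simp
    then show "qs' ! i \<in> Dy" by (rule div'(2))
    show "Rest lt (gs ! i) \<in> Dy"
      by (rule Dy_subset[of "gs ! i"]) (use gs[OF nth_mem[OF i]] Exps_Rest in blast)+
  qed simp
  moreover have "\<forall>w\<in>Exps F'. e_weight w = k"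
  proof
    fix w assume "w \<in> Exps F'"
    then obtain i u v where i: "i < length gs" and u: "u \<in> Exps (qs' ! i)"
      and v: "v \<in> Exps (gs ! i)" and w: "w = u + v"
      using Exps_F' by blast
    show "e_weight w = k"
      using weight'[OF i u] hom[OF nth_mem[OF i] v] by (simp add: w)
  qed
  moreover have "f = (\<Sum>i<length gs. cmult (map2 (+) qs qs' ! i) (gs ! i)) + (r + r') + F'"
  proof -
    have "(\<Sum>i<length gs. cmult (map2 (+) qs qs' ! i) (gs ! i)) =
        (\<Sum>i<length gs. cmult (qs ! i) (gs ! i)) + (\<Sum>i<length gs. cmult (qs' ! i) (gs ! i))"
      by (simp add: lq lq' cmult_add_left flip: sum.distrib)
    \<comment> \<open>Replacing leading terms by the full divisors overshoots by the products with
      \<open>Rest\<close>, which \<open>F'\<close> compensates.\<close>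
    moreover have "(\<Sum>i<length gs. cmult (qs' ! i) (LT lt (gs ! i))) =
        (\<Sum>i<length gs. cmult (qs' ! i) (gs ! i)) + F'"
      unfolding F'_def Rest_def by (simp add: cmult_diff_right sum_subtractf)
    moreover have "f = s + (r + r') + F'"
      if "s = a + b" "l = b + F'" "f = a + r + F" "F = l + r'" for a b l s
      using that by (simp add: add_ac)
    ultimately show ?thesis using inv(5) div'(4) by iprover
  qed
  moreover have "set (map2 (+) qs qs') \<subseteq> Dy"
    using inv(2) div unfolding is_LT_division_def by (intro set_map2_add_Dy) simp_all
  moreover have "(\<forall>i<length gs. (\<lambda>u. LE lt (gs ! i) + u) ` Exps (map2 (+) qs qs' ! i)
        \<subseteq> Delta (map (LE lt) gs) i) \<and>
      (\<forall>i<length gs. \<forall>u\<in>Exps (map2 (+) qs qs' ! i). e_weight u + e_weight (LE lt (gs ! i)) = k)"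
  proof (intro conjI allI impI image_subsetI ballI)
    fix i u assume i: "i < length gs" and "u \<in> Exps (map2 (+) qs qs' ! i)"
    then have "u \<in> Exps (qs ! i + qs' ! i)" by (simp add: lq lq')
    then have u: "u \<in> Exps (qs ! i) \<or> u \<in> Exps (qs' ! i)" using Exps_add by fast
    show "LE lt (gs ! i) + u \<in> Delta (map (LE lt) gs) i"
      using u inv(6)[OF i] div'(5)[OF i] by metis
    show "e_weight u + e_weight (LE lt (gs ! i)) = k"
      using u inv(9)[OF i] weight'[OF i] by metis
  qed
  moreover have "r + r' \<in> Dy" using inv(3) div'(3) by (rule Dy_add)
  moreover have "Exps (r + r') \<subseteq> Delta_bar (map (LE lt) gs)"
    using inv(7) div'(6) Exps_add[of r r'] by blast
  moreover have "length (map2 (+) qs qs') = length gs" by (simp add: lq lq')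
  ultimately show "Kx_invariant lt f gs k (map2 (+) qs qs', r + r', F')"
    unfolding Kx_invariant_def split by (elim conjE) (intro conjI; assumption)
qed

lemma Kx_approx_division_correct:
  fixes gs :: "('n::finite, 'k::field_char_0) coeffs list"
  assumes "term_order lt\<^sub>1"
    and gs: "\<And>g. g \<in> set gs \<Longrightarrow> g \<in> Dy \<and> g \<noteq> 0"
    and hom: "\<And>g u. g \<in> set gs \<Longrightarrow> u \<in> Exps g \<Longrightarrow> e_weight u = e_weight (LE (less_r lt\<^sub>1) g)"
    and f: "f \<in> Dy" "\<And>u. u \<in> Exps f \<Longrightarrow> e_weight u = k"
  shows "\<exists>qs r F. Kx_approx_division (less_r lt\<^sub>1) f gs B = Some (qs, r, F) \<and>
    Kx_invariant (less_r lt\<^sub>1) f gs k (qs, r, F) \<and> (\<forall>u\<in>Exps F. B \<le> total_deg u)"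
proof -
  let ?lt = "less_r lt\<^sub>1"
  note ord = less_r_order[OF assms(1)]
  let ?b = "\<lambda>(qs, r, F). F \<noteq> 0 \<and> total_deg (LE ?lt F) < B"
  let ?c = "\<lambda>(qs, r, F).
          let (qs', r') = LT_division ?lt F gs
          in (map2 (+) qs qs', r + r', - (\<Sum>i<length gs. cmult (qs' ! i) (Rest ?lt (gs ! i))))"
  let ?I = "Kx_invariant ?lt f gs k"
  let ?s = "(replicate (length gs) 0, 0, f)"
  \<comment> \<open>\<open>less_r\<close> has infinite descents, with growing degree, so only
    exponents of degree below \<open>B\<close> are counted. Closing downwards from the support makes
    the set shrink at each pass: all new exponents are below \<open>LE ?lt F\<close>, which itself
    drops out.\<close>
  define below where "below F = {w. total_deg w < B \<and> (\<exists>v\<in>Exps F. w = v \<or> ?lt w v)}"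
    for F :: "('n, 'k) coeffs"
  have fin: "finite (below F)" for F
    by (rule finite_subset[OF _ finite_total_deg_less[of B]]) (auto simp: below_def)
  let ?m = "\<lambda>(qs :: ('n, 'k) coeffs list, r :: ('n, 'k) coeffs, F). card (below F)"
  have init: "?I ?s"
    unfolding Kx_invariant_def using f by (auto simp: sum.neutral)
  have step: "?I (?c s) \<and> ?m (?c s) < ?m s" if s: "?I s" "?b s" for s
  proof -
    obtain qs r F where [simp]: "s = (qs, r, F)" by (cases s)
    obtain qs' r' where d: "LT_division ?lt F gs = (qs', r')" by fastforce
    define F' where "F' = - (\<Sum>i<length gs. cmult (qs' ! i) (Rest ?lt (gs ! i)))"
    have F: "F \<in> Dy" "F \<noteq> 0" "total_deg (LE ?lt F) < B"
      using s by (simp_all add: Kx_invariant_def)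
    have div: "is_LT_division ?lt F gs qs' r'"
      using is_LT_division_LT_division[OF F(1) LE_greatest(1)[OF ord(1-3)] d] gs by blast
    have K: "?I (map2 (+) qs qs', r + r', F')" "\<forall>w\<in>Exps F'. ?lt w (LE ?lt F)"
      using Kx_step[OF ord gs hom _ F(2) div] s(1) unfolding F'_def by simp_all
    have LE_F: "LE ?lt F \<in> Exps F" using LE_greatest(1)[OF ord(1-3) F(1,2)] .
    have "below F' \<subseteq> below F - {LE ?lt F}"
    proof
      fix w assume "w \<in> below F'"
      then have "total_deg w < B" "?lt w (LE ?lt F)"
        using K(2) transpD[OF ord(1)] unfolding below_def by blast+
      moreover have "w \<noteq> LE ?lt F" using calculation(2) asympD[OF ord(3)] by metis
      ultimately show "w \<in> below F - {LE ?lt F}" using LE_F unfolding below_def by blast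
    qed
    moreover have "LE ?lt F \<in> below F" using LE_F F(3) unfolding below_def by blast
    ultimately have "card (below F') < card (below F)"
      using fin by (intro psubset_card_mono) blast+
    then show ?thesis using K(1) by (simp add: d F'_def)
  qed
  obtain t where t: "while_option ?b ?c ?s = Some t"
    using measure_while_option_Some[where P = ?I and b = ?b and c = ?c and f = ?m, OF step init] by blast
  have I: "?I t"
    by (rule while_option_rule[where P = ?I, OF _ t init]) (use step in blast)
  have stop: "\<not> ?b t" using t by (rule while_option_stop)
  obtain qs r F where [simp]: "t = (qs, r, F)" by (cases t)
  \<comment> \<open>A \<open>less_r\<close>-smaller exponent has at least the same degree, so the
    stop condition on the leading exponent bounds the whole support.\<close>
  have "B \<le> total_deg u" if u: "u \<in> Exps F" for u
  proof -
    have "F \<noteq> 0" using u by (metis Exps_zero empty_iff)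
    then have "B \<le> total_deg (LE ?lt F)" using stop by simp
    moreover have "u = LE ?lt F \<or> ?lt u (LE ?lt F)"
      using LE_greatest(2)[OF ord(1-3) _ \<open>F \<noteq> 0\<close> u] I by (auto simp: Kx_invariant_def)
    ultimately show ?thesis by (auto simp: less_r_def)
  qed
  then show ?thesis
    using t I unfolding Kx_approx_division_def by auto
qed

section \<open>The main loop\<close>

lemma dmult_high_weight:
  assumes "Q \<in> Dy" and low: "\<And>u. u \<in> Exps P \<Longrightarrow> e_weight u + ord_e Q \<le> k"
    and "k < e_weight w"
  shows "dmult P Q w = 0"
proof (rule ccontr)
  assume "dmult P Q w \<noteq> 0"
  then show False
  proof (rule dmult_nonzeroE)
    fix u v \<kappa> assume uv: "u \<in> Exps P" "v \<in> Exps Q" "u + v = w + (\<kappa>, 0, \<kappa>)"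
    have "e_weight u + e_weight v = e_weight w + sum \<kappa> UNIV"
      using arg_cong[OF uv(3), of e_weight] by simp
    then show False
      using low[OF uv(1)] e_weight_le_ord_e[OF assms(1) uv(2)] \<open>k < e_weight w\<close> by linarith
  qed
qed

text \<open>This is the value of Bound when pass \<open>k\<close> begins.\<close>

definition degree_bound ::
  "('n::finite expo \<Rightarrow> 'n expo \<Rightarrow> bool) \<Rightarrow> ('n, 'k::zero) coeffs list \<Rightarrow> nat \<Rightarrow> nat \<Rightarrow> nat"
where
  "degree_bound lt\<^sub>1 Ps N k = N + (\<Sum>j\<le>k. M_bound lt\<^sub>1 Ps j)"

lemma M_bound_ge:
  assumes "i < length Ps" "ord_e (Ps ! i) \<le> k"
  shows "total_deg (LE (less_e lt\<^sub>1) (Ps ! i)) + 2 * (k - ord_e (Ps ! i)) \<le> M_bound lt\<^sub>1 Ps k"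
proof -
  define h where "h i = total_deg (LE (less_e lt\<^sub>1) (Ps ! i)) + 2 * (k - ord_e (Ps ! i))" for i
  define S where "S = {h i | i. i < length Ps \<and> ord_e (Ps ! i) \<le> k}"
  have "S \<subseteq> h ` {..<length Ps}" unfolding S_def by blast
  then have "finite S" by (rule finite_subset) simp
  moreover have "h i \<in> S" unfolding S_def using assms by blast
  moreover have "M_bound lt\<^sub>1 Ps k = (if S = {} then 0 else Max S)"
    by (simp only: M_bound_def Let_def S_def h_def)
  ultimately have "h i \<le> M_bound lt\<^sub>1 Ps k" by auto
  then show ?thesis by (simp only: h_def)
qed

text \<open>The larger bound contains the summand \<open>M_bound lt\<^sub>1 Ps k'\<close>, absent
  from the smaller one, and by \<open>M_bound_ge\<close> it covers the stated gap. The gap is the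
  margin for the Leibniz corrections that fall from weight \<open>k'\<close> to
  \<open>k\<close>.\<close>

lemma degree_bound_growth:
  assumes "i < length Ps" "k < k'" "ord_e (Ps ! i) \<le> k'"
  shows "degree_bound lt\<^sub>1 Ps N k + total_deg (LE (less_e lt\<^sub>1) (Ps ! i)) + (k' - ord_e (Ps ! i))
    \<le> degree_bound lt\<^sub>1 Ps N k'"
proof -
  have "sum (M_bound lt\<^sub>1 Ps) {..k} + M_bound lt\<^sub>1 Ps k' = sum (M_bound lt\<^sub>1 Ps) (insert k' {..k})"
    using assms(2) by simp
  also have "\<dots> \<le> sum (M_bound lt\<^sub>1 Ps) {..k'}"
    using assms(2) by (intro sum_mono2) auto
  finally show ?thesis
    using M_bound_ge[OF assms(1,3), of lt\<^sub>1] unfolding degree_bound_def by linarith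
qed

text \<open>The weights from \<open>m\<close> on have been treated, each up to its own degree bound;
  remainder terms of smaller weight or larger degree are left free. The quotients satisfy their
  support condition without any cutoff.\<close>

definition approx_invariant ::
  "('n::finite expo \<Rightarrow> 'n expo \<Rightarrow> bool) \<Rightarrow> ('n, 'k::field_char_0) coeffs \<Rightarrow> ('n, 'k) coeffs list \<Rightarrow>
   nat \<Rightarrow> nat \<Rightarrow> ('n, 'k) coeffs list \<Rightarrow> ('n, 'k) coeffs \<Rightarrow> bool"
where
  "approx_invariant lt\<^sub>1 P Ps N m Qs R \<longleftrightarrow>
     length Qs = length Ps \<and> set Qs \<subseteq> Dy \<and> R \<in> Dy \<and>
     P = (\<Sum>i<length Ps. dmult (Qs ! i) (Ps ! i)) + R \<and>
     (\<forall>i<length Ps. \<forall>u. u \<in> Exps (Qs ! i) \<longrightarrow>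
        LE (less_e lt\<^sub>1) (Ps ! i) + u \<in> Delta (map (LE (less_e lt\<^sub>1)) Ps) i) \<and>
     (\<forall>w. w \<in> Exps R \<longrightarrow> m \<le> e_weight w \<longrightarrow> total_deg w < degree_bound lt\<^sub>1 Ps N (e_weight w) \<longrightarrow>
        w \<in> Delta_bar (map (LE (less_e lt\<^sub>1)) Ps))"

lemma approx_invariantD:
  assumes "approx_invariant lt\<^sub>1 P Ps N m Qs R"
  shows "length Qs = length Ps" "set Qs \<subseteq> Dy" "R \<in> Dy"
    and "P = (\<Sum>i<length Ps. dmult (Qs ! i) (Ps ! i)) + R"
    and "i < length Ps \<Longrightarrow> u \<in> Exps (Qs ! i) \<Longrightarrow>
      LE (less_e lt\<^sub>1) (Ps ! i) + u \<in> Delta (map (LE (less_e lt\<^sub>1)) Ps) i"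
    and "w \<in> Exps R \<Longrightarrow> m \<le> e_weight w \<Longrightarrow> total_deg w < degree_bound lt\<^sub>1 Ps N (e_weight w) \<Longrightarrow>
      w \<in> Delta_bar (map (LE (less_e lt\<^sub>1)) Ps)"
  using assms unfolding approx_invariant_def by iprover+

text \<open>
  The quotients of pass \<open>k\<close> are homogeneous, so subtracting their multiples leaves the terms of
  weight above \<open>k\<close> alone and acts in weight \<open>k\<close> by the commutative products with the initial parts.
\<close>

lemma approx_step_correct:
  fixes Ps :: "('n::finite, 'k::field_char_0) coeffs list"
  assumes "term_order lt\<^sub>1"
    and Ps: "\<And>p. p \<in> set Ps \<Longrightarrow> p \<in> Dy \<and> p \<noteq> 0"
    and inv: "approx_invariant lt\<^sub>1 P Ps N (Suc k) Qs R"
    and B: "B = degree_bound lt\<^sub>1 Ps N k"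
  shows "\<exists>Qs' R'. approx_step lt\<^sub>1 Ps k (B, Qs, R) = Some (B - M_bound lt\<^sub>1 Ps k, Qs', R') \<and>
    approx_invariant lt\<^sub>1 P Ps N k Qs' R'"
proof -
  let ?le = "LE (less_e lt\<^sub>1)" and ?lr = "LE (less_r lt\<^sub>1)" and ?gs = "map in_e Ps"
  let ?f = "low_part k B R"
  note inv = approx_invariantD[OF inv]
  note lQ = inv(1) and Qs = inv(2) and R = inv(3) and P = inv(4)
  have lead: "?lr (in_e p) = ?le p" "e_weight (?le p) = ord_e p" if "p \<in> set Ps" for p
    using LE_in_e[OF assms(1), of p] e_weight_LE[OF assms(1), of p] Ps[OF that] by simp_all
  have lead_nth: "?lr (?gs ! i) = ?le (Ps ! i)" "e_weight (?le (Ps ! i)) = ord_e (Ps ! i)"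
    "Ps ! i \<in> Dy" if "i < length Ps" for i
    using lead[of "Ps ! i"] Ps[of "Ps ! i"] that by simp_all
  have leads: "map ?lr ?gs = map ?le Ps"
    by (simp add: lead)
  have gs: "g \<in> Dy \<and> g \<noteq> 0" if g: "g \<in> set ?gs" for g
  proof -
    obtain p where "p \<in> set Ps" "g = in_e p" using g by (simp only: set_map) (rule imageE)
    then show ?thesis using Ps[of p] in_e_Dy[of p] in_e_nonzero[of p] by simp
  qed
  have hom: "e_weight u = e_weight (?lr g)" if g: "g \<in> set ?gs" and u: "u \<in> Exps g" for g u
  proof -
    obtain p where p: "p \<in> set Ps" "g = in_e p" using g by (simp only: set_map) (rule imageE)
    then show ?thesis using lead[OF p(1)] u by (simp add: Exps_in_e)
  qed
  have f: "?f \<in> Dy"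
    using R by (rule Dy_subset) (auto simp: Exps_def low_part_def)
  have f_k: "e_weight u = k" if "u \<in> Exps ?f" for u
    using that by (simp add: Exps_def low_part_def split: if_splits)
  have "\<exists>qs r F. Kx_approx_division (less_r lt\<^sub>1) ?f ?gs B = Some (qs, r, F) \<and>
      Kx_invariant (less_r lt\<^sub>1) ?f ?gs k (qs, r, F) \<and> (\<forall>u\<in>Exps F. B \<le> total_deg u)"
    by (rule Kx_approx_division_correct) (fact assms(1) gs hom f f_k)+
  then obtain qs r F where K: "Kx_approx_division (less_r lt\<^sub>1) ?f ?gs B = Some (qs, r, F)"
    and I: "Kx_invariant (less_r lt\<^sub>1) ?f ?gs k (qs, r, F)"
    and F: "\<forall>u\<in>Exps F. B \<le> total_deg u"
    by (elim exE conjE)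
  note I = Kx_invariantD[OF I, unfolded length_map leads]
  have lq: "length qs = length Ps" using I(1) .
  have qD: "qs ! i \<in> Dy" "Qs ! i \<in> Dy" if "i < length Ps" for i
    using I(2) Qs that by (simp_all add: lq lQ subset_code(1))
  have weight: "e_weight u + ord_e (Ps ! i) = k" if "i < length Ps" "u \<in> Exps (qs ! i)" for i u
    using I(9)[OF that] that(1) by (simp only: lead_nth)
  let ?S = "\<Sum>i<length Ps. dmult (qs ! i) (Ps ! i)"
  let ?Q = "map2 (+) Qs qs"
  have S_high: "?S w = 0" if "k < e_weight w" for w
    unfolding sum_fun_apply
  proof (rule sum.neutral, rule ballI)
    fix i assume "i \<in> {..<length Ps}"
    then have i: "i < length Ps" by simp
    show "dmult (qs ! i) (Ps ! i) w = 0"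
      using lead_nth(3)[OF i] weight[OF i] that by (intro dmult_high_weight[where k = k]) simp_all
  qed
  have S_k: "?S w = ?f w - r w - F w" if w: "e_weight w = k" for w
  proof -
    have "?S w = (\<Sum>i<length Ps. cmult (qs ! i) (?gs ! i) w)"
      unfolding sum_fun_apply
    proof (rule sum.cong)
      fix i assume "i \<in> {..<length Ps}"
      then have i: "i < length Ps" by simp
      have "dmult (qs ! i) (Ps ! i) w = cmult (qs ! i) (in_e (Ps ! i)) w"
        using lead_nth(3)[OF i] weight[OF i] w by (intro dmult_eq_cmult_in_e) simp_all
      then show "dmult (qs ! i) (Ps ! i) w = cmult (qs ! i) (?gs ! i) w" using i by simp
    qed simp
    moreover have "?f w = (\<Sum>i<length Ps. cmult (qs ! i) (?gs ! i) w) + r w + F w"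
      using fun_cong[OF I(5), of w] by (simp add: sum_fun_apply)
    ultimately show ?thesis by simp
  qed
  have "approx_invariant lt\<^sub>1 P Ps N k ?Q (R - ?S)"
    unfolding approx_invariant_def
  proof (intro conjI allI impI)
    show "length ?Q = length Ps" by (simp add: lq lQ)
    show "set ?Q \<subseteq> Dy" using Qs I(2) by (rule set_map2_add_Dy)
    show "R - ?S \<in> Dy"
      using R qD lead_nth(3) by (intro Dy_diff Dy_sum dmult_Dy) simp_all
    have "(\<Sum>i<length Ps. dmult (?Q ! i) (Ps ! i)) = (\<Sum>i<length Ps. dmult (Qs ! i) (Ps ! i)) + ?S"
      unfolding sum.distrib[symmetric]
    proof (rule sum.cong)
      fix i assume "i \<in> {..<length Ps}"
      then have i: "i < length Ps" by simp
      then have "?Q ! i = Qs ! i + qs ! i" by (simp add: lq lQ)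
      then show "dmult (?Q ! i) (Ps ! i) = dmult (Qs ! i) (Ps ! i) + dmult (qs ! i) (Ps ! i)"
        using dmult_add_left[OF Dy_imp_Dhat_y[OF qD(2)[OF i]] Dy_imp_Dhat_y[OF qD(1)[OF i]]] by simp
    qed simp
    then show "P = (\<Sum>i<length Ps. dmult (?Q ! i) (Ps ! i)) + (R - ?S)"
      using P by simp
  next
    fix i u assume i: "i < length Ps" and "u \<in> Exps (?Q ! i)"
    then have "u \<in> Exps (Qs ! i + qs ! i)" by (simp add: lq lQ)
    then have "u \<in> Exps (Qs ! i) \<or> u \<in> Exps (qs ! i)" using Exps_add by fast
    moreover have "?le (Ps ! i) + u \<in> Delta (map ?le Ps) i" if "u \<in> Exps (qs ! i)"
      using I(6)[OF i that] by (simp only: lead_nth[OF i])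
    ultimately show "?le (Ps ! i) + u \<in> Delta (map ?le Ps) i"
      using inv(5)[OF i] by metis
  next
    fix w assume w: "w \<in> Exps (R - ?S)" "k \<le> e_weight w"
      "total_deg w < degree_bound lt\<^sub>1 Ps N (e_weight w)"
    show "w \<in> Delta_bar (map ?le Ps)"
    proof (cases "e_weight w = k")
      case True
      \<comment> \<open>In weight \<open>k\<close> and below the bound, \<open>low_part\<close>
        agrees with \<open>R\<close> and \<open>F\<close> has no terms, so the subtraction leaves
        exactly \<open>r\<close>.\<close>
      then have low: "total_deg w < B" using w(3) B by simp
      have "w \<notin> Exps F"
      proof
        assume "w \<in> Exps F"
        then show False using bspec[OF F] low by fastforce
      qed
      then have "(R - ?S) w = r w"
        using S_k[OF True] True low by (simp add: low_part_def Exps_def)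
      then have "w \<in> Exps r" using w(1) unfolding Exps_def mem_Collect_eq by metis
      then show ?thesis by (rule I(7))
    next
      case False
      then have "w \<in> Exps R" using S_high[of w] w(1,2) by (simp add: Exps_def)
      then show ?thesis by (rule inv(6)) (use w False in simp_all)
    qed
  qed
  then show ?thesis
    unfolding approx_step_def by (simp add: K)
qed

text \<open>With \<open>m\<close> passes to go, the next one has index \<open>m - 1\<close>, so the
  bound sums over \<open>j < m\<close>. For \<open>m = Suc k\<close> this is
  \<open>degree_bound\<close> at \<open>k\<close>, and the pass removes the last summand.\<close>

lemma approx_loop_correct:
  fixes Ps :: "('n::finite, 'k::field_char_0) coeffs list"
  assumes "term_order lt\<^sub>1" "\<And>p. p \<in> set Ps \<Longrightarrow> p \<in> Dy \<and> p \<noteq> 0"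
    and "approx_invariant lt\<^sub>1 P Ps N m Qs R"
    and "B = N + (\<Sum>j<m. M_bound lt\<^sub>1 Ps j)"
  shows "\<exists>B' Qs' R'. approx_loop lt\<^sub>1 Ps m (B, Qs, R) = Some (B', Qs', R') \<and>
    approx_invariant lt\<^sub>1 P Ps N 0 Qs' R'"
  using assms(3,4)
proof (induction m arbitrary: B Qs R)
  case 0
  then show ?case by simp
next
  case (Suc k)
  have "B = degree_bound lt\<^sub>1 Ps N k"
    using Suc.prems(2) by (simp add: degree_bound_def lessThan_Suc_atMost)
  then obtain Qs' R' where
    "approx_step lt\<^sub>1 Ps k (B, Qs, R) = Some (B - M_bound lt\<^sub>1 Ps k, Qs', R')"
    "approx_invariant lt\<^sub>1 P Ps N k Qs' R'"
    using approx_step_correct[OF assms(1,2) Suc.prems(1)] by blast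
  moreover have "B - M_bound lt\<^sub>1 Ps k = N + (\<Sum>j<k. M_bound lt\<^sub>1 Ps j)"
    using Suc.prems(2) by simp
  ultimately show ?case using Suc.IH[of Qs' R' "B - M_bound lt\<^sub>1 Ps k"] by simp
qed

lemma Dhat_approx_division_correct:
  fixes Ps :: "('n::finite, 'k::field_char_0) coeffs list"
  assumes "term_order lt\<^sub>1" "\<And>p. p \<in> set Ps \<Longrightarrow> p \<in> Dy \<and> p \<noteq> 0" and P: "P \<in> Dy"
  shows "\<exists>Qs R. Dhat_approx_division lt\<^sub>1 P Ps N = Some (Qs, R) \<and>
    approx_invariant lt\<^sub>1 P Ps N 0 Qs R"
proof -
  \<comment> \<open>Before the first pass no term of \<open>P\<close> has weight \<open>m\<close> or
    more, so nothing is claimed about the remainder. For \<open>P = 0\<close> this holds with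
    \<open>m = 0\<close>.\<close>
  have init: "approx_invariant lt\<^sub>1 P Ps N m (replicate (length Ps) 0) P"
    if "\<And>w. w \<in> Exps P \<Longrightarrow> e_weight w < m" for m
    using P that unfolding approx_invariant_def by (fastforce simp: leD sum.neutral)
  show ?thesis
  proof (cases "P = 0")
    case True
    then show ?thesis using init[of 0] by (simp add: Dhat_approx_division_def)
  next
    case False
    have "e_weight w < Suc (ord_e P)" if "w \<in> Exps P" for w
      using e_weight_le_ord_e[OF P that] by simp
    then obtain B' Qs' R' where
      "approx_loop lt\<^sub>1 Ps (Suc (ord_e P))
         (N + (\<Sum>k\<le>ord_e P. M_bound lt\<^sub>1 Ps k), replicate (length Ps) 0, P) = Some (B', Qs', R')"
      "approx_invariant lt\<^sub>1 P Ps N 0 Qs' R'"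
      using approx_loop_correct[OF assms(1,2) init[of "Suc (ord_e P)"]]
      by (auto simp del: approx_loop.simps simp: lessThan_Suc_atMost)
    then show ?thesis
      using False by (simp add: Dhat_approx_division_def del: approx_loop.simps)
  qed
qed

section \<open>Comparison with the exact division\<close>

text \<open>The weight sees only y and \<xi>, whose exponents are finite in number, so even a power
  series support has a top weight.\<close>

lemma finite_e_weight_Dhat_y:
  assumes "P \<in> Dhat_y"
  shows "finite (e_weight ` Exps P)"
proof -
  have "e_weight ` Exps P = (\<lambda>s. fst s + sum (snd s) UNIV) ` snd ` Exps P"
    unfolding image_image by (simp add: e_weight_def y_exp_def xi_exp_def)
  then show ?thesis using assms by (simp add: Dhat_y_def)
qed

text \<open>
  The exponent \<open>w\<close> chosen in the proof is the leading exponent of exactly one summand. The lower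
  order terms of the Leibniz rule do not reach it: the contractions of an exponent \<open>u\<close> of a quotient
  down to weight \<open>k\<close> lose at most \<open>e_weight u - k\<close> in degree, and by \<open>growth\<close> the bound drops by more.
\<close>

lemma division_of_zero_degree_ge:
  fixes Ps :: "('n::finite, 'k::field_char_0) coeffs list" and E :: "nat \<Rightarrow> ('n, 'k) coeffs"
  assumes lt: "term_order lt\<^sub>1"
    and Ps: "\<And>p. p \<in> set Ps \<Longrightarrow> p \<in> Dy \<and> p \<noteq> 0"
    and E: "\<And>i. i < length Ps \<Longrightarrow> E i \<in> Dhat_y" and S: "S \<in> Dhat_y"
    and zero: "(\<Sum>i<length Ps. dmult (E i) (Ps ! i)) + S = 0"
    and ED: "\<And>i u. i < length Ps \<Longrightarrow> u \<in> Exps (E i) \<Longrightarrow>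
      LE (less_e lt\<^sub>1) (Ps ! i) + u \<in> Delta (map (LE (less_e lt\<^sub>1)) Ps) i"
    and SD: "\<And>w. w \<in> Exps S \<Longrightarrow> total_deg w < b (e_weight w) \<Longrightarrow>
      w \<in> Delta_bar (map (LE (less_e lt\<^sub>1)) Ps)"
    and growth: "\<And>i k k'. i < length Ps \<Longrightarrow> k < k' \<Longrightarrow> ord_e (Ps ! i) \<le> k' \<Longrightarrow>
      b k + total_deg (LE (less_e lt\<^sub>1) (Ps ! i)) + (k' - ord_e (Ps ! i)) \<le> b k'"
  shows "i < length Ps \<Longrightarrow> u \<in> Exps (E i) \<Longrightarrow>
      b (e_weight (LE (less_e lt\<^sub>1) (Ps ! i) + u)) \<le> total_deg (LE (less_e lt\<^sub>1) (Ps ! i) + u)"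
    and "w \<in> Exps S \<Longrightarrow> b (e_weight w) \<le> total_deg w"
proof -
  define a where "a i = LE (less_e lt\<^sub>1) (Ps ! i)" for i
  let ?as = "map (LE (less_e lt\<^sub>1)) Ps"
  \<comment> \<open>Besides the support of \<open>S\<close>, \<open>Y\<close> contains for each
    quotient term the exponent of its product with the leading term. Both claims say that no element
    of \<open>Y\<close> is below its bound, that is, \<open>X\<close> is empty.\<close>
  define Y where "Y = Exps S \<union> (\<Union>i<length Ps. (\<lambda>u. a i + u) ` Exps (E i))"
  define X where "X = {w \<in> Y. total_deg w < b (e_weight w)}"
  have in_Y: "a i + u \<in> Y" if "i < length Ps" "u \<in> Exps (E i)" for i u
    using that unfolding Y_def by blast
  note ord = less_r_order[OF lt]
  have Pi: "Ps ! i \<in> Dy" "Ps ! i \<noteq> 0" if "i < length Ps" for i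
    using Ps[of "Ps ! i"] that by simp_all
  have a_weight: "e_weight (a i) = ord_e (Ps ! i)" if "i < length Ps" for i
    unfolding a_def using e_weight_LE[OF lt Pi[OF that]] .
  have a_lead: "a i \<in> Exps (Ps ! i)" "\<And>v. v \<in> Exps (in_e (Ps ! i)) \<Longrightarrow> v \<noteq> a i \<Longrightarrow> less_r lt\<^sub>1 v (a i)"
    if i: "i < length Ps" for i
  proof -
    show "a i \<in> Exps (Ps ! i)"
      unfolding a_def using LE_greatest(1)[OF less_e_order[OF lt] Pi[OF i]] .
    show "less_r lt\<^sub>1 v (a i)" if "v \<in> Exps (in_e (Ps ! i))" "v \<noteq> a i" for v
      using LE_greatest(2)[OF ord(1-3) in_e_Dy[OF Pi(1)[OF i]] in_e_nonzero[OF Pi[OF i]] that(1)] that(2)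
      unfolding a_def LE_in_e[OF lt Pi[OF i]] by simp
  qed
  have "X = {}"
  proof (rule ccontr)
    assume "X \<noteq> {}"
    \<comment> \<open>\<open>X\<close> may be infinite, but its weights are finite in number, and at
      the top weight \<open>k\<close> the degree bound leaves finitely many exponents to choose
      \<open>w\<close> from.\<close>
    have "e_weight ` X \<subseteq> e_weight ` Exps S \<union>
        (\<Union>i<length Ps. (\<lambda>j. e_weight (a i) + j) ` e_weight ` Exps (E i))"
      unfolding X_def Y_def by (rule image_subsetI) (force simp: image_iff)
    then have fin: "finite (e_weight ` X)"
      by (rule finite_subset) (simp add: finite_e_weight_Dhat_y E S)
    define k where "k = Max (e_weight ` X)"
    have k_max: "e_weight w \<le> k" if "w \<in> X" for w
      unfolding k_def using fin that by simp
    define Xk where "Xk = {w \<in> X. e_weight w = k}"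
    have "k \<in> e_weight ` X" unfolding k_def using fin \<open>X \<noteq> {}\<close> by simp
    then have "Xk \<noteq> {}" unfolding Xk_def by (metis (mono_tags, lifting) empty_Collect_eq imageE)
    moreover have "Xk \<subseteq> {w. total_deg w < b k}"
      unfolding Xk_def X_def by blast
    then have "finite Xk" using finite_total_deg_less by (rule finite_subset)
    ultimately have "\<exists>g\<in>Xk. \<forall>x\<in>Xk. x \<noteq> g \<longrightarrow> less_r lt\<^sub>1 x g"
      using ord by (intro Finite_Set.bex_greatest_element) (auto intro: transp_on_subset totalp_on_subset)
    then obtain w where w: "w \<in> Xk" and w_max: "\<And>x. x \<in> Xk \<Longrightarrow> x \<noteq> w \<Longrightarrow> less_r lt\<^sub>1 x w"
      by (elim bexE) simp
    have w_k: "e_weight w = k" "total_deg w < b k" "w \<in> Y"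
      using w unfolding Xk_def X_def by blast+
    have dmult_w: "dmult (E i) (Ps ! i) w = cmult (E i) (in_e (Ps ! i)) w" if i: "i < length Ps" for i
    proof (rule dmult_eq_cmult_in_e)
      show "Ps ! i \<in> Dy" using Pi i by simp
      fix u v \<kappa> assume u: "u \<in> Exps (E i)" and v: "v \<in> Exps (Ps ! i)" "\<kappa> \<le> x_exp v"
        and uv: "u + v = w + (\<kappa>, 0, \<kappa>)"
      show "e_weight u + ord_e (Ps ! i) \<le> e_weight w"
      proof (rule ccontr)
        assume "\<not> ?thesis"
        then have gt: "k < e_weight u + ord_e (Ps ! i)" using w_k by simp
        have k': "e_weight (a i + u) = e_weight u + ord_e (Ps ! i)" using a_weight[OF i] by simp
        \<comment> \<open>By maximality of \<open>k\<close> the heavier exponent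
          \<open>a i + u\<close> respects its bound, so \<open>growth\<close> gives
          \<open>b k + e_weight u \<le> total_deg u\<close>. The balances of degree and weight, with
          \<open>sum \<kappa> UNIV \<le> x_deg v\<close>, give
          \<open>total_deg u \<le> total_deg w + e_weight u\<close>. Together
          \<open>b k \<le> total_deg w\<close>, a contradiction.\<close>
        then have "a i + u \<notin> X" using k_max[of "a i + u"] gt by linarith
        then have "b (e_weight u + ord_e (Ps ! i)) \<le> total_deg (a i) + total_deg u"
          using in_Y[OF i u] k' unfolding X_def by (simp add: add.commute)
        moreover have "b k + total_deg (a i) + e_weight u \<le> b (e_weight u + ord_e (Ps ! i))"
          using growth[OF i gt] unfolding a_def by simp
        moreover have "total_deg u + total_deg v = total_deg w + 2 * sum \<kappa> UNIV"
          "e_weight u + e_weight v = e_weight w + sum \<kappa> UNIV"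
          using arg_cong[OF uv, of total_deg] arg_cong[OF uv, of e_weight] by simp_all
        moreover have "sum \<kappa> UNIV \<le> x_deg v"
          unfolding x_deg_def using v(2) by (intro sum_mono) (simp add: le_fun_def)
        ultimately show False
          using w_k total_deg_eq[of v] by linarith
      qed
    qed
    \<comment> \<open>For any other \<open>v\<close>, the exponent \<open>a i + u\<close> would be
      \<open>less_r\<close>-greater than \<open>w\<close> with the same weight and no larger degree.
      It would then lie in \<open>Xk\<close>, against the choice of \<open>w\<close>.\<close>
    have lead: "v = a i"
      if i: "i < length Ps" and u: "u \<in> Exps (E i)" and v: "v \<in> Exps (in_e (Ps ! i))" and "u + v = w"
      for i u v
    proof (rule ccontr)
      assume "v \<noteq> a i"
      then have "less_r lt\<^sub>1 v (a i)" by (rule a_lead(2)[OF i v])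
      then have less: "less_r lt\<^sub>1 w (a i + u)"
        using ord(4)[of v "a i" u] \<open>u + v = w\<close> by (simp add: add.commute)
      have "e_weight v = e_weight (a i)" using v a_weight[OF i] by (simp add: Exps_in_e)
      then have "e_weight (a i + u) = k" using w_k(1) \<open>u + v = w\<close>[symmetric] by simp
      moreover have "total_deg (a i + u) \<le> total_deg w" using less by (auto simp: less_r_def)
      ultimately have "a i + u \<in> Xk"
        using in_Y[OF i u] w_k(2) unfolding Xk_def X_def by simp
      moreover have "a i + u \<noteq> w" using less asympD[OF ord(3)] by metis
      ultimately have "less_r lt\<^sub>1 (a i + u) w" by (rule w_max)
      then show False using less asympD[OF ord(3)] by metis
    qed
    have coeff: "dmult (E i) (Ps ! i) w = E i u * (Ps ! i) (a i)"
      if i: "i < length Ps" and u: "w = a i + u" for i u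
    proof -
      have "cmult (E i) (in_e (Ps ! i)) w = E i u * in_e (Ps ! i) (a i)"
        unfolding u by (rule cmult_eq_single) (use lead[OF i] u in simp)
      then show ?thesis
        using dmult_w[OF i] a_weight[OF i] by (simp add: in_e_def)
    qed
    have D: "w \<in> Delta ?as i" if i: "i < length ?as" and nz: "dmult (E i) (Ps ! i) w \<noteq> 0" for i
    proof -
      have i': "i < length Ps" using i by simp
      have "cmult (E i) (in_e (Ps ! i)) w \<noteq> 0" using nz dmult_w[OF i'] by simp
      then show ?thesis
      proof (rule cmult_nonzeroE)
        fix u v assume uv: "u + v = w" "u \<in> Exps (E i)" "v \<in> Exps (in_e (Ps ! i))"
        have "v = a i" by (rule lead[OF i' uv(2,3,1)])
        then have "w = a i + u" using uv(1) by (simp add: add.commute)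
        then show ?thesis using ED[OF i' uv(2)] unfolding a_def by simp
      qed
    qed
    have "((\<Sum>i<length Ps. dmult (E i) (Ps ! i)) + S) w = 0" using zero by simp
    then have sum_w: "(\<Sum>i<length ?as. dmult (E i) (Ps ! i) w) + S w = 0"
      by (simp add: sum_fun_apply)
    \<comment> \<open>If \<open>w\<close> occurs in \<open>S\<close>, it lies in
      \<open>Delta_bar\<close> and every product vanishes there. Otherwise it lies in one piece,
      whose product contributes a nonzero quotient coefficient times a nonzero leading coefficient.
      Either way one nonzero contribution stays uncancelled.\<close>
    show False
    proof (cases "w \<in> Exps S")
      case True
      then have "w \<in> Delta_bar ?as" using SD w_k by simp
      have "(\<Sum>i<length ?as. dmult (E i) (Ps ! i) w) = 0"
        by (rule sum_on_partition(2)) (use D \<open>w \<in> Delta_bar ?as\<close> in simp_all)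
      then show False using sum_w True by (simp add: Exps_def)
    next
      case False
      then obtain i u where i: "i < length Ps" and u: "u \<in> Exps (E i)" "w = a i + u"
        using w_k(3) unfolding Y_def by blast
      have wD: "w \<in> Delta ?as i" using ED[OF i u(1)] unfolding u(2) a_def .
      have "(\<Sum>i<length ?as. dmult (E i) (Ps ! i) w) = dmult (E i) (Ps ! i) w"
        by (rule sum_on_partition(1)) (use D i wD in simp_all)
      then show False
        using sum_w False coeff[OF i u(2)] u(1) a_lead(1)[OF i] by (simp add: Exps_def)
    qed
  qed
  then have low: "b (e_weight w) \<le> total_deg w" if "w \<in> Y" for w
    using that unfolding X_def by (metis (mono_tags, lifting) empty_Collect_eq not_le)
  show "w \<in> Exps S \<Longrightarrow> b (e_weight w) \<le> total_deg w"
    using low[of w] unfolding Y_def by simp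
  show "b (e_weight (LE (less_e lt\<^sub>1) (Ps ! i) + u)) \<le> total_deg (LE (less_e lt\<^sub>1) (Ps ! i) + u)"
    if "i < length Ps" "u \<in> Exps (E i)"
    using low[OF in_Y[OF that]] unfolding a_def .
qed

text \<open>The differences of quotients and remainders form a division of 0, and every
  \<open>degree_bound\<close> is at least \<open>N\<close>. A disagreement of quotients at
  \<open>u\<close> is measured at the leading exponent plus \<open>u\<close>, which accounts for the
  shifted threshold.\<close>

lemma approx_invariant_agrees:
  fixes Ps :: "('n::finite, 'k::field_char_0) coeffs list"
  assumes lt: "term_order lt\<^sub>1" and Ps: "\<And>p. p \<in> set Ps \<Longrightarrow> p \<in> Dy \<and> p \<noteq> 0"
    and inv: "approx_invariant lt\<^sub>1 P Ps N 0 Qs' R'"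
    and div: "is_Dhat_division lt\<^sub>1 P Ps Qs R"
  shows "i < length Ps \<Longrightarrow> total_deg (LE (less_e lt\<^sub>1) (Ps ! i)) + total_deg u < N \<Longrightarrow>
      (Qs' ! i) u = (Qs ! i) u"
    and "total_deg w < N \<Longrightarrow> R' w = R w"
proof -
  let ?le = "LE (less_e lt\<^sub>1)"
  let ?as = "map ?le Ps"
  let ?E = "\<lambda>i. Qs ! i - Qs' ! i"
  let ?b = "degree_bound lt\<^sub>1 Ps N"
  note inv = approx_invariantD[OF inv] and div = div[unfolded is_Dhat_division_def]
  have Q: "Qs ! i \<in> Dhat_y" "Qs' ! i \<in> Dhat_y" if "i < length Ps" for i
    using inv(1,2) div that by (simp_all add: subset_code(1) Dy_imp_Dhat_y)
  have R: "R \<in> Dhat_y" "R' \<in> Dhat_y"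
    using inv(3) div by (simp_all add: Dy_imp_Dhat_y)
  have ED: "?le (Ps ! i) + u \<in> Delta ?as i" if i: "i < length Ps" and u: "u \<in> Exps (?E i)" for i u
  proof -
    have "u \<in> Exps (Qs ! i) \<or> u \<in> Exps (Qs' ! i)" using u Exps_diff by fast
    moreover have "?le (Ps ! i) + u \<in> Delta ?as i" if "u \<in> Exps (Qs ! i)"
      using div i that by (simp add: image_subset_iff)
    moreover have "?le (Ps ! i) + u \<in> Delta ?as i" if "u \<in> Exps (Qs' ! i)"
      using i that by (rule inv(5))
    ultimately show ?thesis by metis
  qed
  have SD: "w \<in> Delta_bar ?as" if w: "w \<in> Exps (R - R')" "total_deg w < ?b (e_weight w)" for w
  proof -
    have "w \<in> Exps R \<or> w \<in> Exps R'" using w(1) Exps_diff by fast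
    moreover have "w \<in> Delta_bar ?as" if "w \<in> Exps R"
      using div that by (blast intro: subsetD)
    moreover have "w \<in> Delta_bar ?as" if "w \<in> Exps R'"
      using that le0 w(2) by (rule inv(6))
    ultimately show ?thesis by metis
  qed
  have "(\<Sum>i<length Ps. dmult (?E i) (Ps ! i)) =
      (\<Sum>i<length Ps. dmult (Qs ! i) (Ps ! i)) - (\<Sum>i<length Ps. dmult (Qs' ! i) (Ps ! i))"
    unfolding sum_subtractf[symmetric]
    by (intro sum.cong refl dmult_diff_left) (use Q in simp_all)
  moreover have "P = (\<Sum>i<length Ps. dmult (Qs ! i) (Ps ! i)) + R"
    "P = (\<Sum>i<length Ps. dmult (Qs' ! i) (Ps ! i)) + R'"
    using inv(4) div by simp_all
  ultimately have zero: "(\<Sum>i<length Ps. dmult (?E i) (Ps ! i)) + (R - R') = 0"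
    by (metis (no_types, lifting) add_diff_add diff_self)
  have E: "?E i \<in> Dhat_y" if "i < length Ps" for i
    using Q[OF that] by (rule Dhat_y_diff)
  have S: "R - R' \<in> Dhat_y" using R by (rule Dhat_y_diff)
  have N: "N \<le> ?b k" for k by (simp add: degree_bound_def)
  show "(Qs' ! i) u = (Qs ! i) u"
    if "i < length Ps" "total_deg (?le (Ps ! i)) + total_deg u < N"
  proof (rule ccontr)
    assume "(Qs' ! i) u \<noteq> (Qs ! i) u"
    then have u: "u \<in> Exps (?E i)" by (simp add: Exps_def)
    have "?b (e_weight (?le (Ps ! i) + u)) \<le> total_deg (?le (Ps ! i) + u)"
      by (rule division_of_zero_degree_ge(1)[where E = ?E])
        (fact lt Ps E S zero ED SD degree_bound_growth that(1) u)+
    then show False using N[of "e_weight (?le (Ps ! i) + u)"] that(2) by simp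
  qed
  show "R' w = R w" if "total_deg w < N"
  proof (rule ccontr)
    assume "R' w \<noteq> R w"
    then have w: "w \<in> Exps (R - R')" by (simp add: Exps_def)
    have "?b (e_weight w) \<le> total_deg w"
      by (rule division_of_zero_degree_ge(2)[where E = ?E])
        (fact lt Ps E S zero ED SD degree_bound_growth w)+
    then show False using N[of "e_weight w"] that by simp
  qed
qed

theorem mainTheorem1:
  fixes lt\<^sub>1 :: "'n::finite expo \<Rightarrow> 'n expo \<Rightarrow> bool"
    and P :: "('n, 'k::field_char_0) coeffs"
    and Ps :: "('n, 'k) coeffs list"
    and N :: nat
  assumes "term_order lt\<^sub>1"
    and "P \<in> Dy"
    and "\<forall>p \<in> set Ps. p \<in> Dy \<and> p \<noteq> 0"
    and "N > 0"
  shows "\<exists>Qs' R'.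
    Dhat_approx_division lt\<^sub>1 P Ps N = Some (Qs', R') \<and>
    length Qs' = length Ps \<and> set Qs' \<subseteq> Dy \<and> R' \<in> Dy \<and>
    P = (\<Sum>i<length Ps. dmult (Qs' ! i) (Ps ! i)) + R' \<and>
    (\<forall>Qs R. is_Dhat_division lt\<^sub>1 P Ps Qs R \<longrightarrow>
       (\<forall>i<length Ps. \<forall>u.
          int (total_deg u) < int N - int (total_deg (LE (less_e lt\<^sub>1) (Ps ! i)))
            \<longrightarrow> (Qs' ! i) u = (Qs ! i) u) \<and>
       (\<forall>u. total_deg u < N \<longrightarrow> R' u = R u))"
proof -
  have Ps: "p \<in> Dy \<and> p \<noteq> 0" if "p \<in> set Ps" for p
    using assms(3) that by (rule bspec)
  obtain Qs' R' where *: "Dhat_approx_division lt\<^sub>1 P Ps N = Some (Qs', R')"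
    and inv: "approx_invariant lt\<^sub>1 P Ps N 0 Qs' R'"
    using Dhat_approx_division_correct[OF assms(1) _ assms(2)] Ps by blast
  show ?thesis
  proof (intro exI conjI allI impI)
    show "Dhat_approx_division lt\<^sub>1 P Ps N = Some (Qs', R')" by (fact *)
    show "length Qs' = length Ps" "set Qs' \<subseteq> Dy" "R' \<in> Dy"
      "P = (\<Sum>i<length Ps. dmult (Qs' ! i) (Ps ! i)) + R'"
      by (fact approx_invariantD[OF inv])+
    fix Qs R assume div: "is_Dhat_division lt\<^sub>1 P Ps Qs R"
    note agrees = approx_invariant_agrees[OF assms(1) Ps inv div]
    show "(Qs' ! i) u = (Qs ! i) u"
      if "i < length Ps" "int (total_deg u) < int N - int (total_deg (LE (less_e lt\<^sub>1) (Ps ! i)))"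
      for i u
      by (rule agrees(1)) (use that in linarith)+
    show "R' u = R u" if "total_deg u < N" for u
      by (rule agrees(2)) (use that in simp_all)
  qed
qed

end
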